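(* Let $W(x,y)=-\log g_\tau(y-(\alpha+\beta x))$ be a linear-Gaussian reference potential, with $\tau$ positive definite, $\alpha\in\mathbb{R}^d$, $\beta\in\mathbb{R}^{d\times d}$ invertible, and put $\chi:=\tau^{-1}\beta$. Let $\mu=\lambda_U$, $\eta=\lambda_V$ be probability measures, and let $K_{\mathbb{W}_{\mu,\eta}}$ and $K_{\mathbb{W}^\flat_{\eta,\mu}}$ be the forward and backward transitions of the Schrödinger bridge from $\mu$ to $\eta$ with reference $P=\mu\times K_W$, with conditional covariance functions $\Sigma_{\mu,\eta}$, $\Sigma^\flat_{\eta,\mu}$, and barycentric projections $K_{\mathbb{W}_{\mu,\eta}}(I)$, $K_{\mathbb{W}^\flat_{\eta,\mu}}(I)$. Then $$\chi'\,\Sigma_{\mu,\eta}\,\chi=\nabla K_{\mathbb{W}_{\mu,\eta}}(I)\,\chi\qquad\text{and}\qquad\chi\,\Sigma^\flat_{\eta,\mu}\,\chi'=\nabla K_{\mathbb{W}^\flat_{\eta,\mu}}(I)\,\chi' .$$ Moreover: (i) If there are positive definite matrices $u_-,v_+$ with $\nabla^2U\le u_-^{-1}$ and $v_+^{-1}\le\nabla^2V$, then $$\nabla K_{\mathbb{W}_{\mu,\eta}}(I)\,\chi\le\chi'\,v_+^{1/2}\,r_{\overline\varpi_0}\,v_+^{1/2}\,\chi\qquad\text{and}\qquad\nabla K_{\mathbb{W}^\flat_{\eta,\mu}}(I)\,\chi'\ge\chi\,u_-^{1/2}\,r_{\varpi_1}\,u_-^{1/2}\,\chi',$$ where $\overline\varpi_0^{-1}:=v_+^{1/2}(\chi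 u_-\chi')v_+^{1/2}$ and $\varpi_1^{-1}:=u_-^{1/2}(\chi'v_+\chi)u_-^{1/2}$. (ii) If there are positive definite matrices $u_+,v_-$ with $u_+^{-1}\le\nabla^2U$ and $\nabla^2V\le v_-^{-1}$, then $$\nabla K_{\mathbb{W}^\flat_{\eta,\mu}}(I)\,\chi'\le\chi\,u_+^{1/2}\,r_{\overline\varpi_1}\,u_+^{1/2}\,\chi'\qquad\text{and}\qquad\nabla K_{\mathbb{W}_{\mu,\eta}}(I)\,\chi\ge\chi'\,v_-^{1/2}\,r_{\varpi_0}\,v_-^{1/2}\,\chi,$$ where $\overline\varpi_1^{-1}:=u_+^{1/2}(\chi'v_-\chi)u_+^{1/2}$ and $\varpi_0^{-1}:=v_-^{1/2}(\chi u_+\chi')v_-^{1/2}$. All inequalities hold pointwise on $\mathbb{R}^d$, in the Loewner order.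
   Context: $\lambda$ is Lebesgue measure on $\mathbb{R}^d$; $g_\tau$ is the density of the centered Gaussian with covariance $\tau$; $\lambda_U(dx)=e^{-U(x)}\lambda(dx)$; $K_W(x,dy)=e^{-W(x,y)}\lambda(dy)$; $A'$ is the transpose; $U,V$ are smooth. The Schrödinger bridge is $P_{\mu,\eta}=\arg\min_{Q\in\Pi(\mu,\eta)}\mathcal{H}(Q|P)$, where $\Pi(\mu,\eta)$ is the set of couplings and $\mathcal{H}$ is relative entropy; it is assumed that some $Q\in\Pi(\mu,\eta)$ has $\mathcal{H}(Q|P)<\infty$ and that the bridge has the form $P_{\mu,\eta}(d(x,y))=\mu(dx)K_{\mathbb{W}_{\mu,\eta}}(x,dy)=\eta(dy)K_{\mathbb{W}^\flat_{\eta,\mu}}(y,dx)$ with $$U(x)+\mathbb{W}_{\mu,\eta}(x,y)=\mathbb{U}(x)+W(x,y)+\mathbb{V}(y)=V(y)+\mathbb{W}^\flat_{\eta,\mu}(y,x),$$ where the smooth functions $(\mathbb{U},\mathbb{V})$ solve the Schrödinger system $\mathbb{U}(x)=U(x)+\log\int e^{-W(x,y)-\mathbb{V}(y)}\lambda(dy)$, $\mathbb{V}(y)=V(y)+\log\int e^{-W(x,y)-\mathbb{U}(x)}\lambda(dx)$ (differentiation under the integral sign being allowed). $\Sigma_{\mu,\eta}(x)$ is the covariance matrix of the probability measure $K_{\mathbb{W}_{\mu,\eta}}(x,\cdot)$ and $K_{\mathbb{W}_{\mu,\eta}}(I)(x)=\int y\,K_{\mathbb{W}_{\mu,\eta}}(x,dy)\in\mathbb{R}^d$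 its mean; $\Sigma^\flat_{\eta,\mu}$ and $K_{\mathbb{W}^\flat_{\eta,\mu}}(I)$ are defined similarly from $K_{\mathbb{W}^\flat_{\eta,\mu}}$. For a vector-valued $h=(h^1,\dots,h^d)'$, $\nabla h:=[\nabla h^1,\dots,\nabla h^d]$, with columns the gradients of the components (the transpose of the Jacobian). For positive definite $\varpi$, $r_\varpi:=-\frac\varpi2+\left(\varpi+(\frac\varpi2)^2\right)^{1/2}$, the unique positive definite fixed point of $s\mapsto(I+(\varpi+s)^{-1})^{-1}$. *)

theory Defs
  imports "HOL-Probability.Probability"
begin

definition psd :: "real^'n^'n \<Rightarrow> bool" where
  "psd A \<longleftrightarrow> transpose A = A \<and> (\<forall>v. 0 \<le> v \<bullet> (A *v v))"

definition posdef :: "real^'n^'n \<Rightarrow> bool" where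
  "posdef A \<longleftrightarrow> transpose A = A \<and> (\<forall>v. v \<noteq> 0 \<longrightarrow> 0 < v \<bullet> (A *v v))"

definition loewner_le :: "real^'n^'n \<Rightarrow> real^'n^'n \<Rightarrow> bool"  (infix "\<preceq>" 50) where
  "A \<preceq> B \<longleftrightarrow> psd (B - A)"

text \<open>The principal square root; meaningful for positive semidefinite arguments only.\<close>

definition msqrt :: "real^'n^'n \<Rightarrow> real^'n^'n" where
  "msqrt A = (THE S. psd S \<and> S ** S = A)"

definition riccati_r :: "real^'n^'n \<Rightarrow> real^'n^'n" where
  "riccati_r w = - ((1/2) *\<^sub>R w) + msqrt (w + ((1/2) *\<^sub>R w) ** ((1/2) *\<^sub>R w))"

primrec C_k :: "nat \<Rightarrow> ('a::real_normed_vector \<Rightarrow> real) \<Rightarrow> bool" where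
  "C_k 0 f \<longleftrightarrow> continuous_on UNIV f"
| "C_k (Suc k) f \<longleftrightarrow>
     (\<forall>x. f differentiable (at x)) \<and> (\<forall>v. C_k k (\<lambda>x. frechet_derivative f (at x) v))"

definition smooth :: "('a::real_normed_vector \<Rightarrow> real) \<Rightarrow> bool" where
  "smooth f \<longleftrightarrow> (\<forall>k. C_k k f)"

definition grad :: "(real^'n \<Rightarrow> real) \<Rightarrow> real^'n \<Rightarrow> real^'n" where
  "grad f x = (\<chi> i. frechet_derivative f (at x) (axis i 1))"

text \<open>The columns of \<open>nabla h x\<close> are the gradients of the components of \<open>h\<close>, that is,
  its entry in row \<open>i\<close> and column \<open>j\<close> is the \<open>i\<close>-th partial derivative of the \<open>j\<close>-th component.\<close>

definition nabla :: "(real^'n \<Rightarrow> real^'m) \<Rightarrow> real^'n \<Rightarrow> real^'m^'n" where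
  "nabla h x = transpose (jacobian h (at x))"

definition hess :: "(real^'n \<Rightarrow> real) \<Rightarrow> real^'n \<Rightarrow> real^'n^'n" where
  "hess f = nabla (grad f)"

definition gauss_density :: "real^'n^'n \<Rightarrow> real^'n \<Rightarrow> real" where
  "gauss_density t z =
     exp (- (z \<bullet> (matrix_inv t *v z)) / 2) / sqrt ((2 * pi) ^ CARD('n) * det t)"

definition pot_measure :: "(real^'n \<Rightarrow> real) \<Rightarrow> (real^'n) measure" where
  "pot_measure U = density lborel (\<lambda>x. ennreal (exp (- U x)))"

definition pot_kernel :: "(real^'n \<Rightarrow> real^'n \<Rightarrow> real) \<Rightarrow> real^'n \<Rightarrow> (real^'n) measure" where
  "pot_kernel W x = pot_measure (W x)"

text \<open>The measure \<open>\<mu>(dx) K(x, dy)\<close> on the product space.\<close>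

definition kernel_prod ::
    "(real^'n) measure \<Rightarrow> (real^'n \<Rightarrow> (real^'n) measure) \<Rightarrow> ((real^'n) \<times> (real^'n)) measure" where
  "kernel_prod \<mu> K = \<mu> \<bind> (\<lambda>x. distr (K x) borel (Pair x))"

definition mean :: "(real^'n) measure \<Rightarrow> real^'n" where
  "mean M = (\<integral>y. y \<partial>M)"

definition covariance :: "(real^'n) measure \<Rightarrow> real^'n^'n" where
  "covariance M = (\<chi> i j. \<integral>y. (y $ i - mean M $ i) * (y $ j - mean M $ j) \<partial>M)"

definition couplings ::
    "(real^'n) measure \<Rightarrow> (real^'n) measure \<Rightarrow> ((real^'n) \<times> (real^'n)) measure set" where
  "couplings \<mu> \<eta> = {Q. sets Q = sets borel \<and> distr Q borel fst = \<mu> \<and> distr Q borel snd = \<eta>}"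

text \<open>The library's \<^const>\<open>KL_divergence\<close> is a Bochner integral, hence real-valued even when the
  relative entropy is infinite. For probability measures \<open>Q\<close> absolutely continuous with respect to
  \<open>P\<close> the negative part of the log-density is always \<open>Q\<close>-integrable, so that non-integrability
  means that the entropy is infinite.\<close>

definition rel_entropy :: "'a measure \<Rightarrow> 'a measure \<Rightarrow> ereal" where
  "rel_entropy Q P =
     (if absolutely_continuous P Q \<and> integrable Q (entropy_density (exp 1) P Q)
      then ereal (KL_divergence (exp 1) P Q) else \<infinity>)"

definition is_schroedinger_bridge ::
    "((real^'n) \<times> (real^'n)) measure \<Rightarrow> (real^'n) measure \<Rightarrow> (real^'n) measure \<Rightarrow>
     ((real^'n) \<times> (real^'n)) measure \<Rightarrow> bool" where
  "is_schroedinger_bridge P \<mu> \<eta> B \<longleftrightarrow>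
     is_arg_min (\<lambda>Q. rel_entropy Q P) (\<lambda>Q. Q \<in> couplings \<mu> \<eta>) B"

text \<open>The integrability clauses say that the integrals in the system are finite; a divergent
  Bochner integral would be \<open>0\<close>.\<close>

definition schroedinger_system ::
    "(real^'n \<Rightarrow> real) \<Rightarrow> (real^'n \<Rightarrow> real) \<Rightarrow> (real^'n \<Rightarrow> real^'n \<Rightarrow> real) \<Rightarrow>
     (real^'n \<Rightarrow> real) \<Rightarrow> (real^'n \<Rightarrow> real) \<Rightarrow> bool" where
  "schroedinger_system U V W UU VV \<longleftrightarrow>
     (\<forall>x. integrable lborel (\<lambda>y. exp (- W x y - VV y)) \<and>
          UU x = U x + ln (\<integral>y. exp (- W x y - VV y) \<partial>lborel)) \<and>
     (\<forall>y. integrable lborel (\<lambda>x. exp (- W x y - UU x)) \<and>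
          VV y = V y + ln (\<integral>x. exp (- W x y - UU x) \<partial>lborel))"

end

theory Submission
  imports Defs
begin

text \<open>
  Everything is read off from two log-Laplace transforms. Completing the square in the Gaussian
  reference density shows that the forward transition from \<open>x\<close> is the density
  \<open>exp (- p)\<close> tilted by the linear functional \<open>y \<mapsto> (chi x) \<bullet> y\<close>, for one fixed potential \<open>p\<close>, and that the
  backward transition from \<open>y\<close> is \<open>exp (- q)\<close> tilted by \<open>x \<mapsto> (chi' y) \<bullet> x\<close>. In an exponential family the
  gradient of the log-Laplace transform is the mean and its Hessian is the covariance; the
  derivative of \<open>x \<mapsto> mean (K x)\<close> is therefore \<open>covariance (K x) chi\<close> by the chain rule, which is the
  identity between covariances and barycentric projections. Differentiation under the integral is justified because
  \<open>chi\<close> is invertible, so that the Schroedinger system makes all exponential moments of both families finite.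

  Write \<open>L p\<close> for the log-Laplace transform of \<open>exp (- p)\<close>. The Schroedinger system says exactly that, up to constants,
  \<open>p y = V y + L q (chi' y)\<close> and \<open>q x = U x + L p (chi x)\<close>. Two dual facts turn curvature of \<open>p\<close> into
  curvature of \<open>L p\<close>: if the Hessian of \<open>p\<close> is at least \<open>A\<close>, then that of \<open>L p\<close> is at most the
  inverse of \<open>A\<close> (Brascamp--Lieb for linear functions), and if it is at most \<open>A\<close>, then that of \<open>L p\<close> is at
  least the inverse of \<open>A\<close> (Cramer--Rao). Both are proved for second differences \<open>f (m + z) + f (m - z) - 2 f m\<close>
  in place of Hessians: the first is the midpoint case of the Prekopa--Leindler inequality, the
  second is the Cauchy--Schwarz inequality after a translation (\<open>second_diff_log_laplace_le\<close>, \<open>second_diff_log_laplace_ge\<close>).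

  Fed into the two relations between \<open>p\<close> and \<open>q\<close>, these facts show that a lower bound for the curvature of \<open>L q\<close>
  yields an upper bound for that of \<open>L p\<close>, which yields a better lower bound for that of \<open>L q\<close>. Starting from mere
  convexity of \<open>L q\<close>, the bounds converge geometrically to a pair of matrices \<open>S\<close>, \<open>T\<close> that
  reproduces itself (\<open>coupled_log_laplace_curvature\<close>). Such a pair is computed by the matrix Riccati
  expression (\<open>riccati_fixed_pair\<close>), whose square roots are handled by the spectral theorem. Part (ii) is
  part (i) with the two marginals exchanged.
\<close>

section \<open>Spectral calculus of symmetric matrices\<close>

lemma quadratic_nonneg_imp_linear_coeff_zero:
  fixes a c :: real
  assumes "\<And>t. 0 \<le> 2 * t * a + t\<^sup>2 * c"
  shows "a = 0"
proof (rule ccontr)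
  assume a: "a \<noteq> 0"
  define d where "d = \<bar>c\<bar> + 1"
  have d: "d > 0" "c < d" by (auto simp: d_def)
  have "2 * (- a / d) * a + (- a / d)\<^sup>2 * c = a\<^sup>2 / d * (c / d - 2)"
    using d by (simp add: field_simps power2_eq_square)
  moreover have "a\<^sup>2 / d * (c / d - 2) < 0"
  proof (rule mult_pos_neg)
    show "a\<^sup>2 / d > 0" using a d by simp
    have "c / d < 1" using d by (simp add: field_simps)
    then show "c / d - 2 < 0" by simp
  qed
  ultimately show False using assms[of "- a / d"] by linarith
qed

lemma symmetric_inner_swap:
  fixes A :: "real^'n^'n"
  assumes "transpose A = A"
  shows "x \<bullet> (A *v y) = (A *v x) \<bullet> y"
  using assms by (metis dot_lmul_matrix transpose_matrix_vector)

text \<open>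
  A maximiser \<open>v\<close> of the quadratic form on the unit sphere of \<open>W\<close> is an eigenvector: with \<open>l\<close> the maximum,
  \<open>l |w|^2 - w \<bullet> A w\<close> is nonnegative on \<open>W\<close> and vanishes at \<open>v\<close>, so its first variation at \<open>v\<close> in
  the direction \<open>l v - A v\<close> vanishes, and that variation is twice the squared length of this vector.
\<close>

lemma symmetric_eigenvector_in_invariant_subspace:
  fixes A :: "real^'n^'n"
  assumes sym: "transpose A = A" and W: "subspace W" and inv: "\<And>w. w \<in> W \<Longrightarrow> A *v w \<in> W"
    and nz: "w0 \<in> W" "w0 \<noteq> 0"
  obtains v l where "v \<in> W" "norm v = 1" "A *v v = l *\<^sub>R v"
proof -
  let ?K = "sphere 0 1 \<inter> W"
  have "compact ?K" by (intro compact_Int_closed compact_sphere closed_subspace W)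
  moreover have "inverse (norm w0) *\<^sub>R w0 \<in> ?K"
    using nz W by (auto simp: subspace_scale)
  moreover have "continuous_on ?K (\<lambda>v. v \<bullet> (A *v v))"
    by (intro continuous_intros linear_continuous_on linear_linear[THEN iffD2] matrix_vector_mul_linear)
  ultimately obtain v where v: "v \<in> ?K" and vmax: "\<And>w. w \<in> ?K \<Longrightarrow> w \<bullet> (A *v w) \<le> v \<bullet> (A *v v)"
    using continuous_attains_sup[of ?K "\<lambda>v. v \<bullet> (A *v v)"] by (metis empty_iff)
  define l where "l = v \<bullet> (A *v v)"
  have nv: "v \<bullet> v = 1" using v by (simp add: dot_square_norm)
  have bound: "w \<bullet> (A *v w) \<le> l * (w \<bullet> w)" if "w \<in> W" for w
  proof (cases "w = 0")
    case False
    have "(inverse (norm w) *\<^sub>R w) \<bullet> (A *v (inverse (norm w) *\<^sub>R w)) \<le> l"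
      unfolding l_def by (rule vmax) (use that False W in \<open>auto simp: subspace_scale\<close>)
    moreover have "(inverse (norm w) *\<^sub>R w) \<bullet> (A *v (inverse (norm w) *\<^sub>R w))
        = (w \<bullet> (A *v w)) / (w \<bullet> w)"
      by (simp add: matrix_vector_mult_scaleR dot_square_norm power2_eq_square divide_inverse)
    ultimately have "(w \<bullet> (A *v w)) / (w \<bullet> w) \<le> l" by simp
    moreover have "w \<bullet> w > 0" using False by simp
    ultimately show ?thesis by (simp only: pos_divide_le_eq)
  qed simp
  \<comment> \<open>The coefficient of \<open>2 t\<close> is the squared length of \<open>b\<close>.\<close>
  define b where "b = l *\<^sub>R v - A *v v"
  have bW: "b \<in> W" unfolding b_def using v inv W by (auto intro!: subspace_diff subspace_scale)
  have "0 \<le> 2 * t * (b \<bullet> b) + t\<^sup>2 * (l * (b \<bullet> b) - b \<bullet> (A *v b))" for t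
  proof -
    have "v + t *\<^sub>R b \<in> W" using v bW W by (auto intro!: subspace_add subspace_scale)
    from bound[OF this]
    have "0 \<le> l * ((v + t *\<^sub>R b) \<bullet> (v + t *\<^sub>R b)) - (v + t *\<^sub>R b) \<bullet> (A *v (v + t *\<^sub>R b))"
      by simp
    also have "\<dots> = l * (v \<bullet> v) - v \<bullet> (A *v v) + 2 * t * (b \<bullet> (l *\<^sub>R v - A *v v))
        + t\<^sup>2 * (l * (b \<bullet> b) - b \<bullet> (A *v b))"
    proof -
      have vb: "v \<bullet> (A *v b) = b \<bullet> (A *v v)"
        using symmetric_inner_swap[OF sym, of v b] by (simp add: inner_commute)
      show ?thesis
        by (simp add: matrix_vector_right_distrib matrix_vector_mult_scaleR inner_add_left
            inner_add_right inner_diff_right vb inner_commute[of v b])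
          (simp add: algebra_simps power2_eq_square)
    qed
    finally show ?thesis by (simp only: nv flip: b_def l_def)
  qed
  then have "b \<bullet> b = 0" by (rule quadratic_nonneg_imp_linear_coeff_zero)
  then have "A *v v = l *\<^sub>R v" by (simp add: b_def)
  with v show thesis by (intro that[of v l]) auto
qed

definition orthonormal_basis :: "(real^'n) set \<Rightarrow> bool" where
  "orthonormal_basis E \<longleftrightarrow> finite E \<and> pairwise orthogonal E \<and> (\<forall>e\<in>E. norm e = 1) \<and> span E = UNIV"

text \<open>
  An orthonormal family of eigenvectors of maximal size spans: otherwise its orthogonal
  complement is a nonzero subspace, invariant because \<open>A\<close> is symmetric, and contains one more eigenvector.
\<close>

theorem symmetric_matrix_eigenbasis:
  fixes A :: "real^'n^'n"
  assumes sym: "transpose A = A"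
  obtains E l where "orthonormal_basis E" "\<And>e. e \<in> E \<Longrightarrow> A *v e = l e *\<^sub>R e"
proof -
  let ?ok = "\<lambda>E. pairwise orthogonal E \<and> (\<forall>e\<in>E. norm e = 1 \<and> (\<exists>l. A *v e = l *\<^sub>R e))"
  have indep: "independent E" if "?ok E" for E :: "(real^'n) set"
    using that by (intro pairwise_orthogonal_independent) auto
  have "\<exists>E. ?ok E \<and> (\<forall>E'. ?ok E' \<longrightarrow> card E' \<le> card E)"
  proof (rule ex_has_greatest_nat[where b = "Suc (DIM(real^'n))"])
    show "?ok {}" by auto
    show "\<forall>E. ?ok E \<longrightarrow> card E < Suc (DIM(real^'n))"
      using indep independent_bound by (metis le_imp_less_Suc)
  qed
  then obtain E where E: "?ok E" and Emax: "\<And>E'. ?ok E' \<Longrightarrow> card E' \<le> card E" by blast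
  have fin: "finite E" using indep[OF E] independent_bound by blast
  have "span E = UNIV"
  proof (rule ccontr)
    assume "span E \<noteq> UNIV"
    then have "span E \<subset> span UNIV" by auto
    then obtain w0 where w0: "w0 \<noteq> 0" "\<And>y. y \<in> span E \<Longrightarrow> orthogonal w0 y"
      using orthogonal_to_subspace_exists_gen[of E UNIV] by auto
    let ?W = "{w. \<forall>e\<in>E. orthogonal e w}"
    have "subspace ?W"
      by (auto simp: subspace_def orthogonal_def inner_add_right)
    moreover have "A *v w \<in> ?W" if "w \<in> ?W" for w
    proof safe
      fix e assume e: "e \<in> E"
      with E obtain l where "A *v e = l *\<^sub>R e" by blast
      then show "orthogonal e (A *v w)"
        using that e by (simp add: orthogonal_def symmetric_inner_swap[OF sym])
    qed
    moreover have "w0 \<in> ?W" using w0(2) by (auto simp: orthogonal_commute span_base)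
    ultimately obtain v l where v: "v \<in> ?W" "norm v = 1" "A *v v = l *\<^sub>R v"
      using symmetric_eigenvector_in_invariant_subspace[OF sym, of ?W w0] w0(1) by blast
    have "?ok (insert v E)"
      using E v by (auto simp: pairwise_insert orthogonal_commute)
    moreover have "v \<notin> E" using v by (auto simp: orthogonal_def)
    ultimately show False using Emax[of "insert v E"] fin by simp
  qed
  then have "orthonormal_basis E" using E fin by (auto simp: orthonormal_basis_def)
  moreover have "\<And>e. e \<in> E \<Longrightarrow> A *v e = (SOME l. A *v e = l *\<^sub>R e) *\<^sub>R e"
  proof -
    fix e assume "e \<in> E"
    then have "\<exists>l. A *v e = l *\<^sub>R e" using E by blast
    then show "A *v e = (SOME l. A *v e = l *\<^sub>R e) *\<^sub>R e" by (rule someI_ex)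
  qed
  ultimately show thesis by (rule that)
qed

text \<open>
  For an orthonormal \<open>E\<close>, the matrix that is diagonal in \<open>E\<close> with eigenvalue \<open>c e\<close> at \<open>e\<close>;
  choosing \<open>c = f \<circ> l\<close> applies \<open>f\<close> to a symmetric matrix with eigenvalues \<open>l\<close>.
\<close>

definition diag_in :: "(real^'n) set \<Rightarrow> (real^'n \<Rightarrow> real) \<Rightarrow> real^'n^'n" where
  "diag_in E c = matrix (\<lambda>x. \<Sum>e\<in>E. (c e * (e \<bullet> x)) *\<^sub>R e)"

lemma diag_in_mult:
  assumes "finite E"
  shows "diag_in E c *v x = (\<Sum>e\<in>E. (c e * (e \<bullet> x)) *\<^sub>R e)"
  unfolding diag_in_def
  by (rule matrix_works, unfold linear_matrix_vector_mul_eq)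
    (auto intro!: linearI simp: inner_add_right scaleR_sum_right algebra_simps sum.distrib)

lemma orthonormal_basis_inner:
  assumes "orthonormal_basis E" "e \<in> E" "f \<in> E"
  shows "e \<bullet> f = (if e = f then 1 else 0)"
  using assms by (auto simp: orthonormal_basis_def pairwise_def orthogonal_def dot_square_norm)

lemma diag_in_eigenvector:
  assumes "orthonormal_basis E" "f \<in> E"
  shows "diag_in E c *v f = c f *\<^sub>R f"
proof -
  have fin: "finite E" using assms by (simp add: orthonormal_basis_def)
  have "(\<Sum>e\<in>E. (c e * (e \<bullet> f)) *\<^sub>R e) = (\<Sum>e\<in>E. if e = f then c f *\<^sub>R f else 0)"
    using assms by (intro sum.cong) (auto simp: orthonormal_basis_inner)
  then show ?thesis using fin assms by (simp add: diag_in_mult)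
qed

lemma matrix_eq_on_basis:
  fixes A B :: "real^'n^'n"
  assumes "orthonormal_basis E" "\<And>e. e \<in> E \<Longrightarrow> A *v e = B *v e"
  shows "A = B"
proof -
  have "A *v x = B *v x" for x
    by (rule linear_eq_on[of "(*v) A" "(*v) B" x E])
      (use assms in \<open>auto simp: orthonormal_basis_def\<close>)
  then show ?thesis by (simp add: matrix_eq)
qed

lemma diag_in_quadratic_form:
  assumes "finite E"
  shows "x \<bullet> (diag_in E c *v x) = (\<Sum>e\<in>E. c e * (e \<bullet> x)\<^sup>2)"
  using assms by (simp add: diag_in_mult inner_sum_right power2_eq_square inner_commute mult.assoc)

lemma transpose_eqI:
  fixes A :: "real^'n^'n"
  assumes "\<And>x y. x \<bullet> (A *v y) = (A *v x) \<bullet> y"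
  shows "transpose A = A"
proof -
  have "(transpose A *v x) \<bullet> y = (A *v x) \<bullet> y" for x y
    by (simp add: transpose_matrix_vector dot_lmul_matrix assms)
  then have "transpose A *v x = A *v x" for x using vector_eq_rdot by blast
  then show ?thesis by (simp add: matrix_eq)
qed

lemma transpose_diag_in:
  assumes "finite E"
  shows "transpose (diag_in E c) = diag_in E c"
proof (rule transpose_eqI)
  show "x \<bullet> (diag_in E c *v y) = (diag_in E c *v x) \<bullet> y" for x y
    unfolding diag_in_mult[OF assms] inner_sum_right inner_sum_left
    by (intro sum.cong) (simp_all add: inner_commute[of x])
qed

lemma ex_basis_inner_nonzero:
  assumes "orthonormal_basis E" "x \<noteq> 0"
  obtains e where "e \<in> E" "e \<bullet> x \<noteq> 0"
proof (rule ccontr)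
  assume "\<not> thesis"
  then have "\<And>e. e \<in> E \<Longrightarrow> orthogonal x e"
    using that by (auto simp: orthogonal_def inner_commute)
  then have "orthogonal x x"
    using assms by (intro orthogonal_to_span[of x E]) (simp_all add: orthonormal_basis_def)
  with assms(2) show False by (simp add: orthogonal_def)
qed

lemma posdef_diag_in:
  fixes E :: "(real^'n) set"
  assumes E: "orthonormal_basis E" and c: "\<And>e. e \<in> E \<Longrightarrow> c e > 0"
  shows "posdef (diag_in E c)"
  unfolding posdef_def
proof (intro conjI allI impI)
  have fin: "finite E" using E by (simp add: orthonormal_basis_def)
  then show "transpose (diag_in E c) = diag_in E c" by (rule transpose_diag_in)
  fix v :: "real^'n" assume "v \<noteq> 0"
  with E obtain e where "e \<in> E" "e \<bullet> v \<noteq> 0" by (rule ex_basis_inner_nonzero)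
  then have "0 < (\<Sum>e\<in>E. c e * (e \<bullet> v)\<^sup>2)"
    by (intro sum_pos2[OF fin]) (use c in \<open>auto simp: less_imp_le\<close>)
  then show "0 < v \<bullet> (diag_in E c *v v)" using fin by (simp add: diag_in_quadratic_form)
qed

lemma psd_diag_in:
  assumes E: "finite E" and c: "\<And>e. e \<in> E \<Longrightarrow> c e \<ge> 0"
  shows "psd (diag_in E c)"
  unfolding psd_def
  using E c by (auto simp: transpose_diag_in diag_in_quadratic_form intro!: sum_nonneg)

lemma posdef_imp_psd: "posdef A \<Longrightarrow> psd A"
  unfolding posdef_def psd_def by (metis inner_zero_left less_imp_le order_refl)

text \<open>
  Uniqueness of the square root, one eigenvector \<open>e\<close> at a time: \<open>f = S e - sqrt (l e) e\<close> satisfies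
  \<open>S f = - sqrt (l e) f\<close>, which positivity of \<open>S\<close> forbids for nonzero \<open>f\<close> and \<open>l e > 0\<close>; for \<open>l e = 0\<close>, the squared length
  of \<open>S e\<close> is \<open>e \<bullet> S (S e) = 0\<close>.
\<close>

lemma psd_square_eq_diag_in:
  assumes E: "orthonormal_basis E" and A: "\<And>e. e \<in> E \<Longrightarrow> A *v e = l e *\<^sub>R e"
    and l: "\<And>e. e \<in> E \<Longrightarrow> l e \<ge> 0" and S: "psd S" "S ** S = A"
  shows "S = diag_in E (\<lambda>e. sqrt (l e))"
proof (rule matrix_eq_on_basis[OF E])
  fix e assume e: "e \<in> E"
  have sym: "transpose S = S" using S by (simp add: psd_def)
  have SS: "S *v (S *v e) = l e *\<^sub>R e"
    using A[OF e] S(2) by (simp add: matrix_vector_mul_assoc)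
  define f where "f = S *v e - sqrt (l e) *\<^sub>R e"
  have Sf: "S *v f = - (sqrt (l e) *\<^sub>R f)"
    using SS l[OF e] by (simp add: f_def matrix_vector_mult_diff_distrib matrix_vector_mult_scaleR algebra_simps)
  have "0 \<le> f \<bullet> (S *v f)" using S(1) by (simp add: psd_def)
  then have "sqrt (l e) * (f \<bullet> f) \<le> 0" by (simp add: Sf)
  then have "f = 0"
  proof (cases "l e = 0")
    case True
    have "(S *v e) \<bullet> (S *v e) = e \<bullet> (S *v (S *v e))"
      using symmetric_inner_swap[OF sym, of e "S *v e"] by simp
    then show ?thesis using SS True by (simp add: f_def)
  next
    case False
    then have "sqrt (l e) > 0" using l[OF e] by simp
    with \<open>sqrt (l e) * (f \<bullet> f) \<le> 0\<close> have "f \<bullet> f \<le> 0"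
      by (simp only: mult_le_0_iff) linarith
    then show ?thesis using inner_gt_zero_iff[of f] by (metis not_less)
  qed
  then show "S *v e = diag_in E (\<lambda>e. sqrt (l e)) *v e"
    by (simp add: f_def diag_in_eigenvector[OF E e])
qed

lemma msqrt_eq_diag_in:
  assumes E: "orthonormal_basis E" and A: "\<And>e. e \<in> E \<Longrightarrow> A *v e = l e *\<^sub>R e"
    and l: "\<And>e. e \<in> E \<Longrightarrow> l e \<ge> 0"
  shows "msqrt A = diag_in E (\<lambda>e. sqrt (l e))"
  unfolding msqrt_def
proof (rule the_equality)
  have fin: "finite E" using E by (simp add: orthonormal_basis_def)
  have "diag_in E (\<lambda>e. sqrt (l e)) ** diag_in E (\<lambda>e. sqrt (l e)) = A"
    using E A l by (intro matrix_eq_on_basis[OF E])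
      (simp add: diag_in_eigenvector matrix_vector_mult_scaleR flip: matrix_vector_mul_assoc)
  then show "psd (diag_in E (\<lambda>e. sqrt (l e))) \<and> diag_in E (\<lambda>e. sqrt (l e)) ** diag_in E (\<lambda>e. sqrt (l e)) = A"
    using fin l by (auto intro!: psd_diag_in)
qed (use psd_square_eq_diag_in[OF assms] in blast)

lemma posdef_eigenbasis:
  assumes "posdef A"
  obtains E l where "orthonormal_basis E" "\<And>e. e \<in> E \<Longrightarrow> A *v e = l e *\<^sub>R e" "\<And>e. e \<in> E \<Longrightarrow> l e > 0"
proof -
  obtain E l where El: "orthonormal_basis E" "\<And>e. e \<in> E \<Longrightarrow> A *v e = l e *\<^sub>R e"
    using symmetric_matrix_eigenbasis assms unfolding posdef_def by metis
  have "l e > 0" if "e \<in> E" for e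
  proof -
    have "norm e = 1" using El(1) that by (simp add: orthonormal_basis_def)
    then have "e \<noteq> 0" by auto
    then have "0 < e \<bullet> (A *v e)" using assms by (simp add: posdef_def)
    also have "\<dots> = l e" using El(2)[OF that] \<open>norm e = 1\<close> by (simp add: dot_square_norm)
    finally show ?thesis .
  qed
  with El show thesis by (intro that)
qed

lemma msqrt_posdef:
  assumes "posdef A"
  shows "posdef (msqrt A)" "msqrt A ** msqrt A = A"
proof -
  obtain E l where El: "orthonormal_basis E" "\<And>e. e \<in> E \<Longrightarrow> A *v e = l e *\<^sub>R e" "\<And>e. e \<in> E \<Longrightarrow> l e > 0"
    using posdef_eigenbasis[OF assms] by metis
  have eq: "msqrt A = diag_in E (\<lambda>e. sqrt (l e))"
    using El by (intro msqrt_eq_diag_in) (auto simp: less_imp_le)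
  show "posdef (msqrt A)" unfolding eq using El by (intro posdef_diag_in) auto
  show "msqrt A ** msqrt A = A"
    unfolding eq using El by (intro matrix_eq_on_basis[OF El(1)])
      (simp add: diag_in_eigenvector matrix_vector_mult_scaleR less_imp_le flip: matrix_vector_mul_assoc)
qed

text \<open>
  In an eigenbasis of \<open>w\<close> the matrix \<open>riccati_r w\<close> is diagonal, and each of its
  eigenvalues \<open>r\<close> is the positive root of \<open>r^2 + l r = l\<close>. This quadratic equation is the fixed point property
  of \<open>s \<mapsto> (I + (w + s)^-1)^-1\<close> with denominators cleared.
\<close>

lemma riccati_r_posdef:
  assumes "posdef w"
  shows "posdef (riccati_r w)" "riccati_r w ** (w + riccati_r w) = w"
proof -
  obtain E l where El: "orthonormal_basis E" "\<And>e. e \<in> E \<Longrightarrow> w *v e = l e *\<^sub>R e" "\<And>e. e \<in> E \<Longrightarrow> l e > 0"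
    using posdef_eigenbasis[OF assms] by metis
  have nn: "l e + (l e / 2)\<^sup>2 \<ge> 0" if "e \<in> E" for e using El(3)[OF that] by simp
  have m: "msqrt (w + ((1/2) *\<^sub>R w) ** ((1/2) *\<^sub>R w)) = diag_in E (\<lambda>e. sqrt (l e + (l e / 2)\<^sup>2))"
    using El nn by (intro msqrt_eq_diag_in)
      (auto simp: matrix_vector_mult_add_rdistrib scaleR_matrix_vector_assoc[symmetric]
        matrix_vector_mult_scaleR algebra_simps power2_eq_square simp flip: matrix_vector_mul_assoc)
  define r where "r e = - (l e / 2) + sqrt (l e + (l e / 2)\<^sup>2)" for e
  have rpos: "r e > 0" if "e \<in> E" for e
  proof -
    have "l e / 2 = sqrt ((l e / 2)\<^sup>2)" using El(3)[OF that] by simp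
    also have "\<dots> < sqrt (l e + (l e / 2)\<^sup>2)" using El(3)[OF that] by (intro real_sqrt_less_mono) simp
    finally show ?thesis by (simp add: r_def)
  qed
  have re: "riccati_r w *v e = r e *\<^sub>R e" if "e \<in> E" for e
  proof -
    have "riccati_r w *v e = diag_in E (\<lambda>e. sqrt (l e + (l e / 2)\<^sup>2)) *v e - (1/2) *\<^sub>R (w *v e)"
      unfolding riccati_r_def m
      by (simp add: matrix_vector_mult_diff_rdistrib scaleR_matrix_vector_assoc)
    then show ?thesis using El(1,2) that by (simp add: diag_in_eigenvector r_def scaleR_left_diff_distrib)
  qed
  have req: "riccati_r w = diag_in E r"
    by (rule matrix_eq_on_basis[OF El(1)]) (simp add: re diag_in_eigenvector[OF El(1)])
  show "posdef (riccati_r w)" unfolding req using El(1) rpos by (rule posdef_diag_in)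
  show "riccati_r w ** (w + riccati_r w) = w"
  proof (rule matrix_eq_on_basis[OF El(1)])
    fix e assume e: "e \<in> E"
    have "r e * (l e + r e) = (sqrt (l e + (l e / 2)\<^sup>2))\<^sup>2 - (l e / 2)\<^sup>2"
      by (simp add: r_def algebra_simps power2_eq_square)
    also have "\<dots> = l e" using nn[OF e] by simp
    finally show "riccati_r w ** (w + riccati_r w) *v e = w *v e"
      using e by (simp add: El(2) re matrix_vector_mult_add_rdistrib matrix_vector_right_distrib
          matrix_vector_mult_scaleR algebra_simps flip: matrix_vector_mul_assoc scaleR_left_distrib)
  qed
qed

section \<open>Positive definite matrices and the Riccati pair\<close>

lemma posdef_imp_invertible:
  assumes "posdef A"
  shows "invertible A"
proof -
  have "x = 0" if "A *v x = 0" for x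
    using assms that unfolding posdef_def by (metis inner_zero_right less_irrefl)
  then have "inj ((*v) A)"
    by (simp add: linear_injective_0[OF matrix_vector_mul_linear])
  then show ?thesis
    using matrix_left_invertible_injective invertible_left_inverse by blast
qed

lemma matrix_inv_cancel:
  fixes A :: "real^'n^'n"
  assumes "invertible A"
  shows "A ** matrix_inv A = mat 1" "matrix_inv A ** A = mat 1"
    "A ** (matrix_inv A ** B) = B" "matrix_inv A ** (A ** B) = B"
proof -
  have "A ** matrix_inv A = mat 1 \<and> matrix_inv A ** A = mat 1"
    unfolding matrix_inv_def by (rule someI_ex) (use assms in \<open>simp add: invertible_def\<close>)
  then show "A ** matrix_inv A = mat 1" "matrix_inv A ** A = mat 1"
    "A ** (matrix_inv A ** B) = B" "matrix_inv A ** (A ** B) = B"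
    by (simp_all add: matrix_mul_assoc)
qed

lemma matrix_inv_eqI:
  fixes A B :: "real^'n^'n"
  assumes "A ** B = mat 1"
  shows "matrix_inv A = B"
proof -
  have "invertible A" using assms by (auto simp: invertible_right_inverse)
  then have "matrix_inv A ** (A ** B) = B" by (rule matrix_inv_cancel)
  then show ?thesis using assms by simp
qed

lemma invertible_matrix_inv: "invertible A \<Longrightarrow> invertible (matrix_inv (A :: real^'n^'n))"
  using matrix_inv_cancel(2) invertible_right_inverse by blast

lemma matrix_inv_matrix_inv: "invertible A \<Longrightarrow> matrix_inv (matrix_inv A) = (A :: real^'n^'n)"
  by (intro matrix_inv_eqI matrix_inv_cancel)

lemma matrix_inv_mul:
  fixes A B :: "real^'n^'n"
  assumes "invertible A" "invertible B"
  shows "matrix_inv (A ** B) = matrix_inv B ** matrix_inv A"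
proof (rule matrix_inv_eqI)
  have "(A ** B) ** (matrix_inv B ** matrix_inv A) = A ** (B ** (matrix_inv B ** matrix_inv A))"
    by (simp add: matrix_mul_assoc)
  also have "\<dots> = mat 1" using assms by (simp add: matrix_inv_cancel)
  finally show "(A ** B) ** (matrix_inv B ** matrix_inv A) = mat 1" .
qed

lemma inner_transpose_mult:
  fixes X :: "real^'n^'m"
  shows "x \<bullet> (transpose X *v y) = (X *v x) \<bullet> y"
  by (metis dot_lmul_matrix transpose_matrix_vector inner_commute)

lemma posdef_matrix_inv:
  assumes "posdef A"
  shows "posdef (matrix_inv A)"
proof -
  have inv: "invertible A" by (rule posdef_imp_invertible[OF assms])
  have sym: "transpose A = A" using assms by (simp add: posdef_def)
  have "matrix_inv A = transpose (matrix_inv A)"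
  proof (rule matrix_inv_eqI)
    have "A ** transpose (matrix_inv A) = transpose (matrix_inv A ** A)"
      by (simp add: matrix_transpose_mul sym)
    then show "A ** transpose (matrix_inv A) = mat 1" by (simp add: matrix_inv_cancel[OF inv])
  qed
  moreover have "0 < v \<bullet> (matrix_inv A *v v)" if "v \<noteq> 0" for v
  proof -
    define w where "w = matrix_inv A *v v"
    have v: "v = A *v w" unfolding w_def
      by (simp add: matrix_vector_mul_assoc matrix_inv_cancel[OF inv])
    have "w \<noteq> 0" using that v by auto
    then have "0 < w \<bullet> (A *v w)" using assms by (simp add: posdef_def)
    then show ?thesis by (simp flip: w_def v) (simp add: v inner_commute)
  qed
  ultimately show ?thesis by (simp add: posdef_def)
qed

lemma posdef_congruence:
  fixes A X :: "real^'n^'n"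
  assumes A: "posdef A" and X: "invertible X"
  shows "posdef (transpose X ** A ** X)"
  unfolding posdef_def
proof (intro conjI allI impI)
  show "transpose (transpose X ** A ** X) = transpose X ** A ** X"
    using A by (simp add: matrix_transpose_mul posdef_def matrix_mul_assoc)
  fix v :: "real^'n" assume "v \<noteq> 0"
  have "v = matrix_inv X *v (X *v v)" by (simp add: matrix_vector_mul_assoc matrix_inv_cancel[OF X])
  then have "X *v v \<noteq> 0" using \<open>v \<noteq> 0\<close> by auto
  then have "0 < (X *v v) \<bullet> (A *v (X *v v))" using A by (simp add: posdef_def)
  then show "0 < v \<bullet> ((transpose X ** A ** X) *v v)"
    by (simp add: inner_transpose_mult del: transpose_matrix_vector flip: matrix_vector_mul_assoc)
qed

lemma posdef_add: "posdef A \<Longrightarrow> posdef B \<Longrightarrow> posdef (A + B)"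
  by (simp add: posdef_def transpose_def vec_eq_iff matrix_vector_mult_add_rdistrib inner_add_right add_pos_pos)

lemma posdef_coercive:
  fixes A :: "real^'n^'n"
  assumes "posdef A"
  obtains a where "a > 0" "\<And>z. a * (z \<bullet> z) \<le> z \<bullet> (A *v z)"
proof -
  let ?R = "msqrt A"
  have R: "posdef ?R" "?R ** ?R = A" by (rule msqrt_posdef[OF assms])+
  then have inv: "invertible ?R" and sym: "transpose ?R = ?R"
    by (auto intro: posdef_imp_invertible simp: posdef_def)
  obtain K where K: "K > 0" "\<And>z. norm (matrix_inv ?R *v z) \<le> norm z * K"
    using bounded_linear.pos_bounded[OF matrix_vector_mul_bounded_linear] by metis
  have "1 / K\<^sup>2 * (z \<bullet> z) \<le> z \<bullet> (A *v z)" for z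
  proof -
    have "norm z \<le> norm (?R *v z) * K"
      using K(2)[of "?R *v z"] by (simp add: matrix_vector_mul_assoc matrix_inv_cancel[OF inv])
    then have "(norm z)\<^sup>2 \<le> (norm (?R *v z) * K)\<^sup>2" by (intro power_mono) auto
    then have "(norm z)\<^sup>2 \<le> (norm (?R *v z))\<^sup>2 * K\<^sup>2" by (simp add: power_mult_distrib)
    moreover have "(norm (?R *v z))\<^sup>2 = z \<bullet> (A *v z)"
      using symmetric_inner_swap[OF sym, of z "?R *v z"] R(2)
      by (simp add: dot_square_norm[symmetric] matrix_vector_mul_assoc)
    ultimately show ?thesis using K(1) by (simp add: divide_le_eq dot_square_norm)
  qed
  then show thesis using K(1) by (intro that[of "1 / K\<^sup>2"]) auto
qed

text \<open>
  The constant that drives the geometric convergence of the coupled bounds.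
\<close>

lemma posdef_dominates_small_multiple:
  fixes A B :: "real^'n^'n"
  assumes "posdef A"
  obtains d where "0 < d" "d \<le> 1" "\<And>z. d * (z \<bullet> (B *v z)) \<le> z \<bullet> (A *v z)"
proof -
  obtain a where a: "a > 0" "\<And>z. a * (z \<bullet> z) \<le> z \<bullet> (A *v z)"
    using posdef_coercive[OF assms] by metis
  obtain K where K: "K > 0" "\<And>z. norm (B *v z) \<le> norm z * K"
    using bounded_linear.pos_bounded[OF matrix_vector_mul_bounded_linear] by metis
  define d where "d = min 1 (a / K)"
  have d: "0 < d" "d \<le> 1" "d * K \<le> a" using a(1) K(1) by (auto simp: d_def min_def field_simps)
  have "d * (z \<bullet> (B *v z)) \<le> z \<bullet> (A *v z)" for z
  proof -
    have "z \<bullet> (B *v z) \<le> norm z * norm (B *v z)" by (rule norm_cauchy_schwarz)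
    also have "\<dots> \<le> norm z * (norm z * K)" by (intro mult_left_mono K) auto
    finally have "d * (z \<bullet> (B *v z)) \<le> d * (K * (z \<bullet> z))"
      using d(1) by (intro mult_left_mono) (auto simp: dot_square_norm power2_eq_square mult_ac)
    also have "\<dots> \<le> a * (z \<bullet> z)" using d(3) by (simp add: mult.assoc[symmetric] mult_right_mono)
    finally show ?thesis using a(2)[of z] by linarith
  qed
  with d show thesis by (intro that)
qed

lemma matrix_mult_add_distrib:
  fixes A B C :: "real^'n^'n"
  shows "A ** (B + C) = A ** B + A ** C" "(B + C) ** A = B ** A + C ** A"
  by (simp_all add: matrix_matrix_mult_def vec_eq_iff sum.distrib algebra_simps)

text \<open>
  Conjugation with the square root of \<open>v\<close> reduces the coupled equations for \<open>S\<close> and \<open>T\<close> to the scalar-looking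
  equation \<open>r (w + r) = w\<close>: the definition of \<open>w\<close> gives \<open>(X T X')^-1 = (X u X')^-1 + S = R (w + r) R\<close> with \<open>R^2 = v\<close>,
  and then \<open>S (v^-1 + X T X') = R (r (w + r) + r) (w + r)^-1 R^-1 = I\<close>.
\<close>

theorem riccati_fixed_pair:
  fixes u v X :: "real^'n^'n"
  assumes u: "posdef u" and v: "posdef v" and X: "invertible X"
    and w: "w = matrix_inv (msqrt v ** (X ** u ** transpose X) ** msqrt v)"
    and S: "S = msqrt v ** riccati_r w ** msqrt v"
    and T: "T = matrix_inv (matrix_inv u + transpose X ** S ** X)"
  shows "posdef S" "posdef T" "matrix_inv S = matrix_inv v + X ** T ** transpose X"
    "matrix_inv T = matrix_inv u + transpose X ** S ** X"
proof -
  define R r where "R = msqrt v" and "r = riccati_r w"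
  define N where "N = X ** u ** transpose X"
  have Xt: "invertible (transpose X)" using X by (rule transpose_invertible)
  have R: "posdef R" "R ** R = v" unfolding R_def by (rule msqrt_posdef[OF v])+
  then have Ri: "invertible R" "transpose R = R" by (auto intro: posdef_imp_invertible simp: posdef_def)
  have N: "posdef N" unfolding N_def using posdef_congruence[OF u Xt] by simp
  have ui: "invertible u" and Ni: "invertible N" using u N by (auto intro: posdef_imp_invertible)
  have "posdef (R ** N ** R)" using posdef_congruence[OF N Ri(1)] by (simp add: Ri(2))
  then have wpos: "posdef w" unfolding w R_def N_def by (rule posdef_matrix_inv)
  have S': "S = R ** r ** R" by (simp add: S R_def r_def)
  have r: "posdef r" "r ** (w + r) = w" unfolding r_def by (rule riccati_r_posdef[OF wpos])+
  show Spos: "posdef S"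
    unfolding S R_def[symmetric] r_def[symmetric] using posdef_congruence[OF r(1) Ri(1)] by (simp add: Ri(2))
  define Q where "Q = matrix_inv u + transpose X ** S ** X"
  have Qpos: "posdef Q" unfolding Q_def
    by (intro posdef_add posdef_matrix_inv u posdef_congruence Spos X)
  then have Qi: "invertible Q" by (rule posdef_imp_invertible)
  have TQ: "T = matrix_inv Q" by (simp add: T Q_def)
  show "posdef T" unfolding TQ by (rule posdef_matrix_inv[OF Qpos])
  show "matrix_inv T = matrix_inv u + transpose X ** S ** X"
    unfolding TQ matrix_inv_matrix_inv[OF Qi] by (rule Q_def)
  note [simp] = matrix_inv_cancel[OF X] matrix_inv_cancel[OF Xt] matrix_inv_cancel[OF Ri(1)]
    matrix_inv_cancel[OF ui] matrix_inv_cancel[OF Qi]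
  note assoc = matrix_mul_assoc[symmetric]
  define Y where "Y = X ** T ** transpose X"
  have wi: "w = matrix_inv R ** matrix_inv N ** matrix_inv R"
    unfolding w N_def[symmetric] R_def[symmetric] using Ri(1) Ni
    by (simp add: matrix_inv_mul invertible_mult matrix_mul_assoc)
  have wr: "invertible (w + r)" by (intro posdef_imp_invertible posdef_add wpos r)
  have Ninv: "matrix_inv N = matrix_inv (transpose X) ** matrix_inv u ** matrix_inv X"
    unfolding N_def using X Xt ui by (simp add: matrix_inv_mul invertible_mult matrix_mul_assoc)
  have "R ** (w + r) ** R = matrix_inv N + S"
    by (simp add: wi matrix_mult_add_distrib assoc S')
  also have "\<dots> = matrix_inv (transpose X) ** Q ** matrix_inv X"
    by (simp add: Ninv Q_def matrix_mult_add_distrib assoc)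
  finally have "Y ** (R ** (w + r) ** R) = mat 1"
    by (simp add: Y_def TQ assoc)
  then have "(R ** (w + r) ** R) ** Y = mat 1" by (simp add: matrix_left_right_inverse)
  then have "matrix_inv (R ** (w + r) ** R) = Y" by (rule matrix_inv_eqI)
  then have Y: "Y = matrix_inv R ** (matrix_inv (w + r) ** matrix_inv R)"
    using Ri(1) wr by (simp add: matrix_inv_mul invertible_mult matrix_mul_assoc)
  have vi: "matrix_inv v = matrix_inv R ** matrix_inv R" unfolding R(2)[symmetric] using Ri by (simp add: matrix_inv_mul)
  have "S ** (matrix_inv v + Y) = R ** ((r + r ** matrix_inv (w + r)) ** matrix_inv R)"
    by (simp add: Y vi S' assoc matrix_mult_add_distrib)
  also have "r + r ** matrix_inv (w + r) = (r ** (w + r) + r) ** matrix_inv (w + r)"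
  proof -
    have "r ** (w + r) ** matrix_inv (w + r) = r"
      unfolding assoc by (simp add: matrix_inv_cancel(1)[OF wr])
    then show ?thesis by (simp only: matrix_mult_add_distrib(2)[where A = "matrix_inv (w + r)"])
  qed
  also have "\<dots> = mat 1" by (simp add: r(2) matrix_inv_cancel[OF wr])
  finally have "S ** (matrix_inv v + Y) = mat 1" by simp
  then show "matrix_inv S = matrix_inv v + X ** T ** transpose X"
    unfolding Y_def by (rule matrix_inv_eqI)
qed

section \<open>The midpoint Prekopa--Leindler inequality\<close>

lemma emeasure_lborel_half_scale:
  fixes M :: "real set"
  assumes "M \<in> sets borel"
  shows "2 * emeasure lborel {y. 2 * y - b \<in> M} = emeasure lborel M"
proof -
  have "emeasure lborel M = (\<integral>\<^sup>+ y. indicator M y \<partial>lborel)" using assms by simp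
  also have "\<dots> = ennreal \<bar>2\<bar> * (\<integral>\<^sup>+ y. indicator M (- b + 2 * y) \<partial>lborel)"
    using assms by (intro nn_integral_real_affine) auto
  also have "(\<integral>\<^sup>+ y. indicator M (- b + 2 * y) \<partial>lborel)
      = (\<integral>\<^sup>+ y. indicator {y. 2 * y - b \<in> M} y \<partial>lborel)"
    by (intro nn_integral_cong) (auto simp: indicator_def)
  also have "\<dots> = emeasure lborel {y. 2 * y - b \<in> M}"
    using assms by (intro nn_integral_indicator) simp
  finally show ?thesis by simp
qed

text \<open>
  Exhausting a set of reals from below without leaving it. It replaces the approximation
  by compact sets in the usual proof of the one-dimensional Brunn--Minkowski inequality.
\<close>

lemma ex_cofinal_sequence:
  fixes A :: "real set"
  assumes "A \<noteq> {}"
  obtains t where "incseq t" "\<And>n. \<exists>a\<in>A. t n \<le> a" "A \<subseteq> (\<Union>n. {..t n})"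
proof -
  consider (max) m where "m \<in> A" "\<And>x. x \<in> A \<Longrightarrow> x \<le> m"
    | (unbounded) "\<not> bdd_above A"
    | (sup) "bdd_above A" "\<And>m. m \<in> A \<Longrightarrow> \<exists>x\<in>A. m < x"
    by (metis not_le)
  then show thesis
  proof cases
    case max
    then show ?thesis by (intro that[of "\<lambda>_. m"]) (auto simp: incseq_def)
  next
    case unbounded
    then show ?thesis
      by (intro that[of real])
        (auto simp: incseq_def bdd_above_def not_le intro: less_imp_le real_arch_simple)
  next
    case sup
    show ?thesis
    proof (rule that[of "\<lambda>n. Sup A - inverse (real (Suc n))"])
      show "incseq (\<lambda>n. Sup A - inverse (real (Suc n)))"
        by (auto simp: incseq_def intro!: le_imp_inverse_le)
      show "\<exists>a\<in>A. Sup A - inverse (real (Suc n)) \<le> a" for n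
      proof -
        have "Sup A - inverse (real (Suc n)) < Sup A" by simp
        then show ?thesis using less_cSupD[OF assms] less_imp_le by metis
      qed
      show "A \<subseteq> (\<Union>n. {..Sup A - inverse (real (Suc n))})"
      proof
        fix x assume "x \<in> A"
        then obtain y where "y \<in> A" "x < y" using sup(2) by blast
        then have "x < Sup A" using sup(1) cSup_upper less_le_trans by metis
        then obtain n where "inverse (real (Suc n)) < Sup A - x"
          using reals_Archimedean[of "Sup A - x"] by auto
        then show "x \<in> (\<Union>n. {..Sup A - inverse (real (Suc n))})"
          by (auto intro!: exI[of _ n])
      qed
    qed
  qed
qed

text \<open>
  For \<open>a \<in> A\<close> and \<open>b \<in> B\<close>, the midpoints of \<open>A \<inter> {..a}\<close> with \<open>b\<close> lie to the left
  of \<open>(a + b) / 2\<close> and those of \<open>a\<close> with \<open>B \<inter> {b<..}\<close> to the right of it, so that their measures add up. Then \<open>a\<close>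
  increases and \<open>b\<close> decreases through cofinal sequences.
\<close>

theorem brunn_minkowski_line:
  fixes A B C :: "real set"
  assumes [measurable]: "A \<in> sets borel" "B \<in> sets borel" "C \<in> sets borel"
    and ne: "A \<noteq> {}" "B \<noteq> {}" and mid: "\<And>a b. a \<in> A \<Longrightarrow> b \<in> B \<Longrightarrow> (a + b) / 2 \<in> C"
  shows "emeasure lborel A + emeasure lborel B \<le> 2 * emeasure lborel C"
proof -
  have split: "emeasure lborel (A \<inter> {..a}) + emeasure lborel (B \<inter> {b..}) \<le> 2 * emeasure lborel C"
    if "a \<in> A" "b \<in> B" for a b
  proof -
    let ?D = "{y. 2 * y - b \<in> A \<inter> {..a}}" and ?E = "{y. 2 * y - a \<in> B \<inter> {b<..}}"
    \<comment> \<open>Dropping the point \<open>b\<close> makes the two sets of midpoints disjoint.\<close>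
    have "AE x in lborel. x \<noteq> b" by (rule AE_lborel_singleton)
    then have "emeasure lborel (B \<inter> {b..}) = emeasure lborel (B \<inter> {b<..})"
      by (intro emeasure_eq_AE) (auto elim!: eventually_mono)
    then have "emeasure lborel (A \<inter> {..a}) + emeasure lborel (B \<inter> {b..})
        = 2 * (emeasure lborel ?D + emeasure lborel ?E)"
      using emeasure_lborel_half_scale[of "A \<inter> {..a}" b] emeasure_lborel_half_scale[of "B \<inter> {b<..}" a]
      by (simp add: distrib_left)
    also have "emeasure lborel ?D + emeasure lborel ?E = emeasure lborel (?D \<union> ?E)"
      by (intro plus_emeasure) auto
    also have "\<dots> \<le> emeasure lborel C"
    proof (intro emeasure_mono)
      show "?D \<union> ?E \<subseteq> C"
      proof
        fix y assume "y \<in> ?D \<union> ?E"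
        then have "((2 * y - b) + b) / 2 \<in> C \<or> (a + (2 * y - a)) / 2 \<in> C"
          using mid[of "2 * y - b" b] mid[of a "2 * y - a"] that by auto
        then show "y \<in> C" by simp
      qed
    qed simp
    finally show ?thesis by (simp add: mult_left_mono)
  qed
  obtain t where t: "incseq t" "\<And>n. \<exists>a\<in>A. t n \<le> a" "A \<subseteq> (\<Union>n. {..t n})"
    using ex_cofinal_sequence[OF ne(1)] by metis
  obtain s where s: "incseq s" "\<And>n. \<exists>b\<in>uminus ` B. s n \<le> b" "uminus ` B \<subseteq> (\<Union>n. {..s n})"
    using ex_cofinal_sequence[of "uminus ` B"] ne(2) by auto
  have le: "emeasure lborel (A \<inter> {..t n}) + emeasure lborel (B \<inter> {- s n..}) \<le> 2 * emeasure lborel C" for n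
  proof -
    obtain a b where ab: "a \<in> A" "t n \<le> a" "b \<in> B" "s n \<le> - b" using t(2)[of n] s(2)[of n] by auto
    have "emeasure lborel (A \<inter> {..t n}) + emeasure lborel (B \<inter> {- s n..})
        \<le> emeasure lborel (A \<inter> {..a}) + emeasure lborel (B \<inter> {b..})"
      using ab by (intro add_mono emeasure_mono) auto
    also have "\<dots> \<le> 2 * emeasure lborel C" using ab by (intro split)
    finally show ?thesis .
  qed
  have "(\<lambda>n. emeasure lborel (A \<inter> {..t n})) \<longlonglongrightarrow> emeasure lborel (\<Union>n. A \<inter> {..t n})"
    using t(1) by (intro Lim_emeasure_incseq) (auto simp: incseq_def intro: order_trans)
  moreover have "(\<Union>n. A \<inter> {..t n}) = A" using t(3) by auto
  moreover have "(\<lambda>n. emeasure lborel (B \<inter> {- s n..})) \<longlonglongrightarrow> emeasure lborel (\<Union>n. B \<inter> {- s n..})"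
  proof (intro Lim_emeasure_incseq)
    show "incseq (\<lambda>n. B \<inter> {- s n..})"
      using s(1) by (intro incseq_SucI) (auto dest: incseq_SucD[of s] intro: order_trans[OF le_imp_neg_le])
  qed auto
  moreover have "(\<Union>n. B \<inter> {- s n..}) = B"
  proof -
    have "\<exists>n. - s n \<le> b" if "b \<in> B" for b using s(3) that by (force simp: minus_le_iff)
    then show ?thesis by auto
  qed
  ultimately have "(\<lambda>n. emeasure lborel (A \<inter> {..t n}) + emeasure lborel (B \<inter> {- s n..}))
      \<longlonglongrightarrow> emeasure lborel A + emeasure lborel B"
    by (intro tendsto_add) auto
  then show ?thesis by (rule LIMSEQ_le_const2) (use le in auto)
qed

text \<open>
  Truncation at 1 restricts the levels to the unit interval. These are the levels at which
  functions with supremum 1 have nonempty superlevel sets, as Brunn--Minkowski requires.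
\<close>

lemma layer_cake_unit_interval:
  fixes f :: "real \<Rightarrow> ennreal"
  assumes [measurable]: "f \<in> borel_measurable borel"
  shows "(\<integral>\<^sup>+ x. min (f x) 1 \<partial>lborel)
    = (\<integral>\<^sup>+ t. indicator {0<..<1} t * emeasure lborel {x. ennreal t < f x} \<partial>lborel)"
proof -
  have slice: "(\<integral>\<^sup>+ t. indicator {0<..<1} t * indicator {x. ennreal t < f x} x \<partial>lborel) = min (f x) 1" for x
  proof -
    define c where "c = enn2real (min (f x) 1)"
    have "min (f x) 1 < \<top>" by (simp add: min_less_iff_disj)
    then have c: "ennreal c = min (f x) 1" by (simp add: c_def)
    have "0 \<le> c" by (simp add: c_def)
    have "ennreal c \<le> ennreal 1" unfolding c by simp
    then have "c \<le> 1" by simp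
    have "(\<integral>\<^sup>+ t. indicator {0<..<1} t * indicator {x. ennreal t < f x} x \<partial>lborel)
        = (\<integral>\<^sup>+ t. indicator {0<..<c} t \<partial>lborel)"
    proof (intro nn_integral_cong)
      fix t :: real
      have "ennreal t < f x \<longleftrightarrow> t < c" if "0 < t" "t < 1"
      proof -
        have "ennreal t < 1" using that by (simp add: ennreal_less_one_iff)
        then have "ennreal t < f x \<longleftrightarrow> ennreal t < min (f x) 1" by simp
        also have "\<dots> \<longleftrightarrow> t < c" using that unfolding c[symmetric] by (simp add: ennreal_less_iff)
        finally show ?thesis .
      qed
      then show "indicator {0<..<1} t * indicator {x. ennreal t < f x} x = (indicator {0<..<c} t :: ennreal)"
        using \<open>c \<le> 1\<close> by (auto simp: indicator_def)
    qed
    also have "\<dots> = min (f x) 1" using \<open>0 \<le> c\<close> by (simp add: c)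
    finally show ?thesis .
  qed
  have "(\<integral>\<^sup>+ x. min (f x) 1 \<partial>lborel)
      = (\<integral>\<^sup>+ x. \<integral>\<^sup>+ t. indicator {0<..<1} t * indicator {x. ennreal t < f x} x \<partial>lborel \<partial>lborel)"
    by (simp add: slice)
  also have "\<dots> = (\<integral>\<^sup>+ t. \<integral>\<^sup>+ x. indicator {0<..<1} t * indicator {x. ennreal t < f x} x \<partial>lborel \<partial>lborel)"
    by (rule lborel_pair.Fubini') measurable
  also have "\<dots> = (\<integral>\<^sup>+ t. indicator {0<..<1} t * emeasure lborel {x. ennreal t < f x} \<partial>lborel)"
    by (intro nn_integral_cong) (simp add: nn_integral_cmult)
  finally show ?thesis .
qed

lemma ennreal_mult_le_mean_square:
  fixes p q c :: ennreal
  assumes "p + q \<le> 2 * c"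
  shows "p * q \<le> c\<^sup>2"
proof (cases "c = \<top>")
  case False
  then have "2 * c < \<top>" by (simp add: ennreal_mult_less_top less_top)
  then have "p + q < \<top>" using assms by (rule le_less_trans[rotated])
  then obtain p' q' where pq: "p = ennreal p'" "q = ennreal q'" "p' \<ge> 0" "q' \<ge> 0"
    by (cases p; cases q) auto
  obtain c' where c: "c = ennreal c'" "c' \<ge> 0" using False by (cases c) auto
  have "ennreal (p' + q') \<le> ennreal (2 * c')" using assms pq c by (simp add: ennreal_mult)
  then have "p' + q' \<le> 2 * c'" using c by (simp add: ennreal_le_iff)
  then have "(p' + q')\<^sup>2 \<le> (2 * c')\<^sup>2" using pq by (intro power_mono) auto
  moreover have "0 \<le> (p' - q')\<^sup>2" by simp
  ultimately have "p' * q' \<le> c'\<^sup>2" by (simp add: power2_eq_square algebra_simps)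
  then have "ennreal (p' * q') \<le> ennreal (c'\<^sup>2)" by (simp add: ennreal_leI)
  then show ?thesis using pq c by (simp add: ennreal_mult ennreal_power)
qed simp

text \<open>
  Equal suprema make the superlevel sets of \<open>f\<close> and \<open>g\<close> at each level below 1 nonempty, and
  their midpoints lie in the superlevel set of \<open>h\<close> at that level. Integrating Brunn--Minkowski over the levels bounds the
  arithmetic mean of the two integrals, hence their geometric mean.
\<close>

lemma prekopa_leindler_line_normalized:
  fixes f g h :: "real \<Rightarrow> ennreal"
  assumes [measurable]: "f \<in> borel_measurable borel" "g \<in> borel_measurable borel" "h \<in> borel_measurable borel"
    and sup: "(SUP x. f x) = 1" "(SUP x. g x) = 1"
    and fgh: "\<And>x y. f x * g y \<le> (h ((x + y) / 2))\<^sup>2"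
  shows "(\<integral>\<^sup>+ x. f x \<partial>lborel) * (\<integral>\<^sup>+ x. g x \<partial>lborel) \<le> (\<integral>\<^sup>+ x. h x \<partial>lborel)\<^sup>2"
proof (rule ennreal_mult_le_mean_square)
  have le1: "min (f x) 1 = f x" "min (g x) 1 = g x" for x
    using SUP_upper[of x UNIV f] SUP_upper[of x UNIV g] sup by (auto simp: min_def)
  have levels: "indicator {0<..<1} t * emeasure lborel {x. ennreal t < f x}
      + indicator {0<..<1} t * emeasure lborel {x. ennreal t < g x}
      \<le> 2 * (indicator {0<..<1} t * emeasure lborel {x. ennreal t < h x})" for t :: real
  proof (cases "0 < t \<and> t < 1")
    case True
    then have t1: "ennreal t < 1" by (simp add: ennreal_less_one_iff)
    have "emeasure lborel {x. ennreal t < f x} + emeasure lborel {x. ennreal t < g x}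
        \<le> 2 * emeasure lborel {x. ennreal t < h x}"
    proof (rule brunn_minkowski_line)
      show "{x. ennreal t < f x} \<noteq> {}" "{x. ennreal t < g x} \<noteq> {}"
        using t1 less_SUP_iff[of "ennreal t" f UNIV] less_SUP_iff[of "ennreal t" g UNIV] sup by auto
      fix a b assume "a \<in> {x. ennreal t < f x}" "b \<in> {x. ennreal t < g x}"
      moreover have "f a < \<top>" "g b < \<top>"
        using le1[of a] le1[of b] by (metis ennreal_one_less_top min.cobounded2 le_less_trans)+
      ultimately obtain r s where rs: "f a = ennreal r" "g b = ennreal s" "t < r" "t < s"
        using True by (cases "f a"; cases "g b") (auto simp: ennreal_less_iff)
      then have "t * t < r * s" using True by (intro mult_strict_mono) auto
      then have "ennreal t * ennreal t < f a * g b"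
        using rs True by (simp add: ennreal_less_iff flip: ennreal_mult)
      also have "\<dots> \<le> (h ((a + b) / 2))\<^sup>2" by (rule fgh)
      finally have "\<not> h ((a + b) / 2) \<le> ennreal t"
        by (metis not_less power2_eq_square mult_mono zero_le)
      then show "(a + b) / 2 \<in> {x. ennreal t < h x}" by (simp add: not_le)
    qed measurable
    then show ?thesis using True by simp
  qed auto
  have "(\<integral>\<^sup>+ x. f x \<partial>lborel) + (\<integral>\<^sup>+ x. g x \<partial>lborel)
     = (\<integral>\<^sup>+ t. indicator {0<..<1} t * emeasure lborel {x. ennreal t < f x}
      + indicator {0<..<1} t * emeasure lborel {x. ennreal t < g x} \<partial>lborel)"
    using layer_cake_unit_interval[of f] layer_cake_unit_interval[of g]
    by (subst nn_integral_add) (auto simp: le1)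
  also have "\<dots> \<le> (\<integral>\<^sup>+ t. 2 * (indicator {0<..<1} t * emeasure lborel {x. ennreal t < h x}) \<partial>lborel)"
    by (intro nn_integral_mono levels)
  also have "\<dots> = 2 * (\<integral>\<^sup>+ x. min (h x) 1 \<partial>lborel)"
    by (subst nn_integral_cmult) (auto simp: layer_cake_unit_interval)
  also have "\<dots> \<le> 2 * (\<integral>\<^sup>+ x. h x \<partial>lborel)"
    by (intro mult_left_mono nn_integral_mono) auto
  finally show "(\<integral>\<^sup>+ x. f x \<partial>lborel) + (\<integral>\<^sup>+ x. g x \<partial>lborel) \<le> 2 * (\<integral>\<^sup>+ x. h x \<partial>lborel)" .
qed


text \<open>
  Reduction to suprema equal to 1: dividing \<open>f\<close> and \<open>g\<close> by their suprema \<open>a\<close> and \<open>b\<close>, and \<open>h\<close> by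
  \<open>sqrt (a b)\<close>, preserves both the hypothesis and the conclusion.
\<close>

lemma prekopa_leindler_line_bounded:
  fixes f g h :: "real \<Rightarrow> ennreal"
  assumes [measurable]: "f \<in> borel_measurable borel" "g \<in> borel_measurable borel" "h \<in> borel_measurable borel"
    and bounded: "(SUP x. f x) < \<top>" "(SUP x. g x) < \<top>"
    and fgh: "\<And>x y. f x * g y \<le> (h ((x + y) / 2))\<^sup>2"
  shows "(\<integral>\<^sup>+ x. f x \<partial>lborel) * (\<integral>\<^sup>+ x. g x \<partial>lborel) \<le> (\<integral>\<^sup>+ x. h x \<partial>lborel)\<^sup>2"
proof (cases "(SUP x. f x) = 0 \<or> (SUP x. g x) = 0")
  case True
  have zero: "f x \<le> (SUP x. f x)" "g x \<le> (SUP x. g x)" for x by (auto intro: SUP_upper)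
  from True show ?thesis
  proof
    assume "(SUP x. f x) = 0"
    then have "f = (\<lambda>_. 0)" using zero(1) by auto
    then show ?thesis by simp
  next
    assume "(SUP x. g x) = 0"
    then have "g = (\<lambda>_. 0)" using zero(2) by auto
    then show ?thesis by simp
  qed
next
  case False
  obtain a where a: "(SUP x. f x) = ennreal a" "a > 0"
    using bounded(1) False by (cases "SUP x. f x") (auto simp: less_le)
  obtain b where b: "(SUP x. g x) = ennreal b" "b > 0"
    using bounded(2) False by (cases "SUP x. g x") (auto simp: less_le)
  define c where "c = sqrt (a * b)"
  have c: "c > 0" "c\<^sup>2 = a * b" using a b by (auto simp: c_def)
  have rescale: "ennreal k * (ennreal (1 / k) * z) = z" if "k > 0" for k z
    using that by (simp add: mult.assoc[symmetric] ennreal_mult[symmetric])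
  define F G H where "F x = ennreal (1 / a) * f x" and "G x = ennreal (1 / b) * g x"
    and "H x = ennreal (1 / c) * h x" for x
  have m[measurable]: "F \<in> borel_measurable borel" "G \<in> borel_measurable borel" "H \<in> borel_measurable borel"
    unfolding F_def G_def H_def by measurable
  have "(\<integral>\<^sup>+ x. F x \<partial>lborel) * (\<integral>\<^sup>+ x. G x \<partial>lborel) \<le> (\<integral>\<^sup>+ x. H x \<partial>lborel)\<^sup>2"
  proof (rule prekopa_leindler_line_normalized[OF m])
    show "(SUP x. F x) = 1" "(SUP x. G x) = 1"
      unfolding F_def G_def using a b by (simp_all flip: SUP_mult_left_ennreal ennreal_mult)
    fix x y
    have "F x * G y = ennreal (1 / c) ^ 2 * (f x * g y)"
      using a b c by (simp add: F_def G_def ennreal_power power_divide ennreal_mult[symmetric] mult_ac)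
    also have "\<dots> \<le> ennreal (1 / c) ^ 2 * (h ((x + y) / 2))\<^sup>2" by (intro mult_left_mono fgh) auto
    finally show "F x * G y \<le> (H ((x + y) / 2))\<^sup>2" by (simp add: H_def power_mult_distrib)
  qed
  then have "ennreal (c\<^sup>2) * ((\<integral>\<^sup>+ x. F x \<partial>lborel) * (\<integral>\<^sup>+ x. G x \<partial>lborel))
      \<le> ennreal (c\<^sup>2) * (\<integral>\<^sup>+ x. H x \<partial>lborel)\<^sup>2"
    by (intro mult_left_mono) auto
  moreover have "ennreal (c\<^sup>2) * ((\<integral>\<^sup>+ x. F x \<partial>lborel) * (\<integral>\<^sup>+ x. G x \<partial>lborel))
      = (ennreal a * (\<integral>\<^sup>+ x. F x \<partial>lborel)) * (ennreal b * (\<integral>\<^sup>+ x. G x \<partial>lborel))"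
    using a b by (simp add: c(2) ennreal_mult mult_ac)
  moreover have "ennreal (c\<^sup>2) * (\<integral>\<^sup>+ x. H x \<partial>lborel)\<^sup>2 = (ennreal c * (\<integral>\<^sup>+ x. H x \<partial>lborel))\<^sup>2"
    using c(1) by (simp add: power_mult_distrib ennreal_power)
  moreover have "ennreal a * (\<integral>\<^sup>+ x. F x \<partial>lborel) = (\<integral>\<^sup>+ x. f x \<partial>lborel)"
    "ennreal b * (\<integral>\<^sup>+ x. G x \<partial>lborel) = (\<integral>\<^sup>+ x. g x \<partial>lborel)"
    "ennreal c * (\<integral>\<^sup>+ x. H x \<partial>lborel) = (\<integral>\<^sup>+ x. h x \<partial>lborel)"
    using a(2) b(2) c(1) by (simp_all add: F_def G_def H_def nn_integral_cmult rescale)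
  ultimately show ?thesis by simp
qed

lemma nn_integral_eq_SUP_truncations:
  fixes f :: "'a \<Rightarrow> ennreal"
  assumes [measurable]: "f \<in> borel_measurable M"
  shows "(\<integral>\<^sup>+ x. f x \<partial>M) = (SUP n. \<integral>\<^sup>+ x. min (f x) (of_nat n) \<partial>M)"
proof -
  have "(SUP n. min (f x) (of_nat n)) = f x" for x
    by (simp add: inf_min[symmetric] ennreal_SUP_of_nat_eq_top flip: inf_SUP)
  then have "(\<integral>\<^sup>+ x. f x \<partial>M) = (\<integral>\<^sup>+ x. (SUP n. min (f x) (of_nat n)) \<partial>M)" by simp
  also have "\<dots> = (SUP n. \<integral>\<^sup>+ x. min (f x) (of_nat n) \<partial>M)"
    by (intro nn_integral_monotone_convergence_SUP) (auto simp: incseq_def le_fun_def min.coboundedI2)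
  finally show ?thesis .
qed

lemma prekopa_leindler_line:
  fixes f g h :: "real \<Rightarrow> ennreal"
  assumes [measurable]: "f \<in> borel_measurable borel" "g \<in> borel_measurable borel" "h \<in> borel_measurable borel"
    and fgh: "\<And>x y. f x * g y \<le> (h ((x + y) / 2))\<^sup>2"
  shows "(\<integral>\<^sup>+ x. f x \<partial>lborel) * (\<integral>\<^sup>+ x. g x \<partial>lborel) \<le> (\<integral>\<^sup>+ x. h x \<partial>lborel)\<^sup>2"
proof -
  have "(\<integral>\<^sup>+ x. min (f x) (of_nat n) \<partial>lborel) * (\<integral>\<^sup>+ x. min (g x) (of_nat m) \<partial>lborel)
      \<le> (\<integral>\<^sup>+ x. h x \<partial>lborel)\<^sup>2" for n m
  proof (rule prekopa_leindler_line_bounded)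
    have "(SUP x. min (f x) (of_nat n)) \<le> of_nat n" "(SUP x. min (g x) (of_nat m)) \<le> of_nat m"
      by (auto intro!: SUP_least)
    then show "(SUP x. min (f x) (of_nat n)) < \<top>" "(SUP x. min (g x) (of_nat m)) < \<top>"
      using of_nat_less_top le_less_trans by blast+
    show "min (f x) (of_nat n) * min (g y) (of_nat m) \<le> (h ((x + y) / 2))\<^sup>2" for x y
      by (rule order_trans[OF mult_mono fgh]) auto
  qed measurable
  then show ?thesis
    by (simp add: nn_integral_eq_SUP_truncations[of f] nn_integral_eq_SUP_truncations[of g]
        SUP_mult_left_ennreal SUP_mult_right_ennreal SUP_le_iff)
qed

text \<open>
  Tensorization: the hypothesis on sections in one coordinate gives, by induction, the
  same hypothesis for the marginals, to which the one-dimensional inequality applies. Marginals may be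
  infinite at some points, which is why the one-dimensional inequality is stated for extended nonnegative functions.
\<close>

lemma prekopa_leindler_PiM:
  fixes f g h :: "('i \<Rightarrow> real) \<Rightarrow> ennreal"
  assumes "finite I"
    and "f \<in> borel_measurable (\<Pi>\<^sub>M i\<in>I. lborel)" "g \<in> borel_measurable (\<Pi>\<^sub>M i\<in>I. lborel)"
      "h \<in> borel_measurable (\<Pi>\<^sub>M i\<in>I. lborel)"
    and "\<And>x y. x \<in> extensional I \<Longrightarrow> y \<in> extensional I \<Longrightarrow> f x * g y \<le> (h (\<lambda>i\<in>I. (x i + y i) / 2))\<^sup>2"
  shows "(\<integral>\<^sup>+ x. f x \<partial>(\<Pi>\<^sub>M i\<in>I. lborel)) * (\<integral>\<^sup>+ x. g x \<partial>(\<Pi>\<^sub>M i\<in>I. lborel))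
    \<le> (\<integral>\<^sup>+ x. h x \<partial>(\<Pi>\<^sub>M i\<in>I. lborel))\<^sup>2"
  using assms
proof (induction I arbitrary: f g h rule: finite_induct)
  case empty
  interpret product_sigma_finite "\<lambda>_. lborel :: real measure" by standard
  have "f (\<lambda>_. undefined) * g (\<lambda>_. undefined) \<le> (h (\<lambda>i\<in>{}. (undefined + undefined) / 2))\<^sup>2"
    by (rule empty.prems(4)) (auto simp: extensional_def)
  then show ?case by (simp add: PiM_empty nn_integral_count_space_finite restrict_def)
next
  case (insert i I)
  note [measurable] = insert.prems(1-3)
  interpret product_sigma_finite "\<lambda>_. lborel :: real measure" by standard
  let ?M = "\<Pi>\<^sub>M i\<in>I. lborel :: real measure"
  have upd[measurable]: "(\<lambda>x. x(i := a)) \<in> measurable ?M (\<Pi>\<^sub>M i\<in>insert i I. lborel)" for a :: real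
    by measurable
  have fubini: "(\<integral>\<^sup>+ x. k x \<partial>(\<Pi>\<^sub>M i\<in>insert i I. lborel)) = (\<integral>\<^sup>+ a. \<integral>\<^sup>+ x. k (x(i := a)) \<partial>?M \<partial>lborel)"
    if "k \<in> borel_measurable (\<Pi>\<^sub>M i\<in>insert i I. lborel)" for k :: "('i \<Rightarrow> real) \<Rightarrow> ennreal"
    using insert.hyps that by (rule product_nn_integral_insert_rev)
  have marginal: "(\<lambda>a. \<integral>\<^sup>+ x. k (x(i := a)) \<partial>?M) \<in> borel_measurable borel"
    if [measurable]: "k \<in> borel_measurable (\<Pi>\<^sub>M i\<in>insert i I. lborel)" for k :: "('i \<Rightarrow> real) \<Rightarrow> ennreal"
  proof -
    interpret I: finite_product_sigma_finite "\<lambda>_. lborel :: real measure" I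
      by standard (rule insert.hyps)
    have "(\<lambda>a. \<integral>\<^sup>+ x. k (x(i := a)) \<partial>?M) \<in> borel_measurable lborel" by measurable
    then show ?thesis by simp
  qed
  show ?case
    unfolding fubini[OF insert.prems(1)] fubini[OF insert.prems(2)] fubini[OF insert.prems(3)]
  proof (rule prekopa_leindler_line)
    fix a b :: real
    show "(\<integral>\<^sup>+ x. f (x(i := a)) \<partial>?M) * (\<integral>\<^sup>+ x. g (x(i := b)) \<partial>?M)
        \<le> (\<integral>\<^sup>+ x. h (x(i := (a + b) / 2)) \<partial>?M)\<^sup>2"
    proof (rule insert.IH)
      fix x y :: "'i \<Rightarrow> real" assume "x \<in> extensional I" "y \<in> extensional I"
      then have "f (x(i := a)) * g (y(i := b))
          \<le> (h (\<lambda>j\<in>insert i I. ((x(i := a)) j + (y(i := b)) j) / 2))\<^sup>2"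
        by (intro insert.prems(4)) (auto simp: extensional_def)
      also have "(\<lambda>j\<in>insert i I. ((x(i := a)) j + (y(i := b)) j) / 2)
          = (\<lambda>j\<in>I. (x j + y j) / 2)(i := (a + b) / 2)"
        using insert.hyps by (auto simp: fun_eq_iff)
      finally show "f (x(i := a)) * g (y(i := b)) \<le> (h ((\<lambda>j\<in>I. (x j + y j) / 2)(i := (a + b) / 2)))\<^sup>2" .
    qed measurable
  qed (intro marginal insert.prems)+
qed

theorem prekopa_leindler_midpoint:
  fixes f g h :: "'a::euclidean_space \<Rightarrow> ennreal"
  assumes [measurable]: "f \<in> borel_measurable borel" "g \<in> borel_measurable borel" "h \<in> borel_measurable borel"
    and fgh: "\<And>x y. f x * g y \<le> (h ((1/2) *\<^sub>R (x + y)))\<^sup>2"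
  shows "(\<integral>\<^sup>+ x. f x \<partial>lborel) * (\<integral>\<^sup>+ x. g x \<partial>lborel) \<le> (\<integral>\<^sup>+ x. h x \<partial>lborel)\<^sup>2"
proof -
  let ?M = "\<Pi>\<^sub>M b\<in>(Basis :: 'a set). lborel :: real measure"
  let ?e = "\<lambda>\<omega>. \<Sum>b\<in>(Basis :: 'a set). \<omega> b *\<^sub>R b"
  have [measurable]: "?e \<in> measurable ?M borel" by measurable
  have coord: "(\<integral>\<^sup>+ x. k x \<partial>lborel) = (\<integral>\<^sup>+ \<omega>. k (?e \<omega>) \<partial>?M)"
    if "k \<in> borel_measurable borel" for k :: "'a \<Rightarrow> ennreal"
    by (subst lborel_eq) (use that in \<open>simp add: nn_integral_distr\<close>)
  show ?thesis
    unfolding coord[OF assms(1)] coord[OF assms(2)] coord[OF assms(3)]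
  proof (rule prekopa_leindler_PiM)
    fix x y :: "'a \<Rightarrow> real"
    have "?e (\<lambda>b\<in>Basis. (x b + y b) / 2) = (1/2) *\<^sub>R (?e x + ?e y)"
      by (simp add: scaleR_sum_right flip: sum.distrib)
        (intro sum.cong, auto simp: scaleR_add_left scaleR_add_right add_divide_distrib)
    then show "f (?e x) * g (?e y) \<le> (h (?e (\<lambda>b\<in>Basis. (x b + y b) / 2)))\<^sup>2"
      using fgh[of "?e x" "?e y"] by (simp only:)
  qed (simp_all, measurable)
qed

section \<open>Curvature of log-Laplace transforms\<close>

text \<open>
  The finite version of the Hessian form \<open>z \<bullet> Hess f m z\<close>.
\<close>

definition second_diff :: "('a::real_vector \<Rightarrow> real) \<Rightarrow> 'a \<Rightarrow> 'a \<Rightarrow> real" where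
  "second_diff f m z = f (m + z) + f (m - z) - 2 * f m"

definition laplace :: "('a::euclidean_space \<Rightarrow> real) \<Rightarrow> 'a \<Rightarrow> real" where
  "laplace p \<theta> = (\<integral>y. exp (\<theta> \<bullet> y - p y) \<partial>lborel)"

definition log_laplace :: "('a::euclidean_space \<Rightarrow> real) \<Rightarrow> 'a \<Rightarrow> real" where
  "log_laplace p \<theta> = ln (laplace p \<theta>)"

text \<open>
  All exponential moments of the measure with density \<open>exp (- p)\<close> are finite.
\<close>

definition laplace_finite :: "('a::euclidean_space \<Rightarrow> real) \<Rightarrow> bool" where
  "laplace_finite p \<longleftrightarrow> p \<in> borel_measurable borel \<and> (\<forall>\<theta>. integrable lborel (\<lambda>y. exp (\<theta> \<bullet> y - p y)))"

lemma laplace_finite_measurable [measurable_dest]: "laplace_finite p \<Longrightarrow> p \<in> borel_measurable borel"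
  by (simp add: laplace_finite_def)

lemma integral_lborel_exp_pos:
  fixes f :: "'a::euclidean_space \<Rightarrow> real"
  assumes int: "integrable lborel (\<lambda>y. exp (f y))"
  shows "0 < (\<integral>y. exp (f y) \<partial>lborel)"
proof -
  have "(\<integral>y. exp (f y) \<partial>lborel) \<noteq> 0"
  proof
    assume "(\<integral>y. exp (f y) \<partial>lborel) = 0"
    then have "AE y in lborel. exp (f y) = 0"
      using int by (subst (asm) integral_nonneg_eq_0_iff_AE) auto
    then have "AE y in (lborel :: 'a measure). False" by simp
    then have "emeasure (lborel :: 'a measure) UNIV = 0" by (simp add: AE_iff_measurable[OF _ refl])
    then show False by simp
  qed
  moreover have "0 \<le> (\<integral>y. exp (f y) \<partial>lborel)" by (intro integral_nonneg_AE) auto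
  ultimately show ?thesis by linarith
qed

lemma laplace_pos: "laplace_finite p \<Longrightarrow> 0 < laplace p \<theta>"
  unfolding laplace_def laplace_finite_def by (intro integral_lborel_exp_pos) auto

lemma exp_log_laplace: "laplace_finite p \<Longrightarrow> exp (log_laplace p \<theta>) = laplace p \<theta>"
  by (simp add: log_laplace_def laplace_pos)

lemma laplace_shift:
  assumes p: "laplace_finite p"
  shows "integrable lborel (\<lambda>y. exp (\<theta> \<bullet> (y + z) - p (y + z)))"
    "(\<integral>y. exp (\<theta> \<bullet> (y + z) - p (y + z)) \<partial>lborel) = laplace p \<theta>"
proof -
  have [measurable]: "p \<in> borel_measurable borel" using p by measurable
  have "integrable (distr lborel borel ((+) z)) (\<lambda>y. exp (\<theta> \<bullet> y - p y))"
    using p by (simp add: lborel_distr_plus laplace_finite_def)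
  then show "integrable lborel (\<lambda>y. exp (\<theta> \<bullet> (y + z) - p (y + z)))"
    by (subst (asm) integrable_distr_eq) (simp_all add: add.commute)
  have "laplace p \<theta> = (\<integral>y. exp (\<theta> \<bullet> y - p y) \<partial>(distr lborel borel ((+) z)))"
    by (simp add: laplace_def lborel_distr_plus)
  also have "\<dots> = (\<integral>y. exp (\<theta> \<bullet> (y + z) - p (y + z)) \<partial>lborel)"
    by (subst integral_distr) (simp_all add: add.commute)
  finally show "(\<integral>y. exp (\<theta> \<bullet> (y + z) - p (y + z)) \<partial>lborel) = laplace p \<theta>" by simp
qed

text \<open>
  A Cramer--Rao inequality. Translating the integrand of \<open>laplace p (\<theta> + h)\<close> by \<open>z\<close> and that of
  \<open>laplace p (\<theta> - h)\<close> by \<open>- z\<close> makes the product of the two at least \<open>exp (2 h \<bullet> z - c)\<close> times the squared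
  integrand of \<open>laplace p \<theta>\<close>, so the claim follows from the Cauchy--Schwarz inequality, here obtained by
  integrating the inequality of arithmetic and geometric means.
\<close>

theorem second_diff_log_laplace_ge:
  assumes p: "laplace_finite p" and c: "\<And>m. second_diff p m z \<le> c"
  shows "2 * (h \<bullet> z) - c \<le> second_diff (log_laplace p) \<theta> h"
proof -
  have [measurable]: "p \<in> borel_measurable borel" using p by measurable
  define a b where "a = log_laplace p (\<theta> + h)" and "b = log_laplace p (\<theta> - h)"
  define k where "k = (2 * (h \<bullet> z) - c) / 2"
  \<comment> \<open>The weight \<open>exp l\<close> balances the two integrals, so that the arithmetic mean below equals their geometric mean.\<close>
  define l where "l = (b - a) / 2"
  let ?f = "\<lambda>y. exp ((\<theta> + h) \<bullet> (y + z) - p (y + z))"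
  let ?g = "\<lambda>y. exp ((\<theta> - h) \<bullet> (y + - z) - p (y + - z))"
  have pointwise: "exp k * exp (\<theta> \<bullet> y - p y) \<le> (exp l * ?f y + exp (- l) * ?g y) / 2" for y
  proof -
    define s where "s = (\<theta> + h) \<bullet> (y + z) - p (y + z) + l"
    define t where "t = (\<theta> - h) \<bullet> (y + - z) - p (y + - z) - l"
    have "2 * (\<theta> \<bullet> y) + 2 * (h \<bullet> z) - (p (y + z) + p (y - z)) = s + t"
      by (simp add: s_def t_def inner_add_left inner_add_right inner_diff_left inner_diff_right)
    then have "k + (\<theta> \<bullet> y - p y) \<le> (s + t) / 2"
      using c[of y] by (simp add: k_def second_diff_def field_simps)
    then have "exp (k + (\<theta> \<bullet> y - p y)) \<le> exp ((s + t) / 2)" by simp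
    also have "\<dots> = exp (s / 2) * exp (t / 2)" by (simp add: add_divide_distrib exp_add)
    also have "\<dots> \<le> ((exp (s / 2))\<^sup>2 + (exp (t / 2))\<^sup>2) / 2"
      using sum_squares_bound[of "exp (s / 2)" "exp (t / 2)"] by simp
    also have "\<dots> = (exp s + exp t) / 2" by (simp add: exp_double[symmetric])
    finally show ?thesis by (simp add: s_def t_def exp_add exp_diff exp_minus field_simps)
  qed
  have "exp k * laplace p \<theta> = (\<integral>y. exp k * exp (\<theta> \<bullet> y - p y) \<partial>lborel)" by (simp add: laplace_def)
  also have "\<dots> \<le> (\<integral>y. (exp l * ?f y + exp (- l) * ?g y) / 2 \<partial>lborel)"
  proof (rule integral_mono[OF _ _ pointwise])
    show "integrable lborel (\<lambda>y. exp k * exp (\<theta> \<bullet> y - p y))"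
      using p by (intro integrable_mult_right) (auto simp: laplace_finite_def)
    show "integrable lborel (\<lambda>y. (exp l * ?f y + exp (- l) * ?g y) / 2)"
      by (intro integrable_divide_zero Bochner_Integration.integrable_add integrable_mult_right laplace_shift[OF p])
  qed
  also have "\<dots> = (exp l * laplace p (\<theta> + h) + exp (- l) * laplace p (\<theta> - h)) / 2"
    unfolding integral_divide_zero
    by (subst Bochner_Integration.integral_add)
      (intro integrable_mult_right laplace_shift[OF p], intro integrable_mult_right laplace_shift[OF p],
       simp only: integral_mult_right_zero laplace_shift[OF p])
  also have "\<dots> = (exp (l + a) + exp (- l + b)) / 2"
    by (simp add: a_def b_def exp_add exp_diff exp_minus exp_log_laplace[OF p] field_simps)
  also have "\<dots> = exp ((a + b) / 2)" by (simp add: l_def field_simps)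
  finally have "exp (k + log_laplace p \<theta>) \<le> exp ((a + b) / 2)" by (simp add: exp_add exp_log_laplace[OF p])
  then have "k + log_laplace p \<theta> \<le> (a + b) / 2" by simp
  then show ?thesis by (simp add: k_def a_def b_def second_diff_def field_simps)
qed

text \<open>
  A Brascamp--Lieb inequality, dual to the preceding one. With \<open>x = m + z\<close> and \<open>y = m - z\<close> the hypothesis
  is precisely the one that Prekopa--Leindler needs for the integrands of \<open>laplace p (\<theta> + h)\<close> and
  \<open>laplace p (\<theta> - h)\<close> against \<open>exp (c / 2)\<close> times that of \<open>laplace p \<theta>\<close>.
\<close>

theorem second_diff_log_laplace_le:
  assumes p: "laplace_finite p" and c: "\<And>m z. 2 * (h \<bullet> z) - c \<le> second_diff p m z"
  shows "second_diff (log_laplace p) \<theta> h \<le> c"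
proof -
  have [measurable]: "p \<in> borel_measurable borel" using p by measurable
  have nn: "(\<integral>\<^sup>+y. ennreal (exp (s \<bullet> y - p y)) \<partial>lborel) = ennreal (laplace p s)" for s
    unfolding laplace_def using p by (intro nn_integral_eq_integral) (auto simp: laplace_finite_def)
  have "(\<integral>\<^sup>+y. ennreal (exp ((\<theta> + h) \<bullet> y - p y)) \<partial>lborel) * (\<integral>\<^sup>+y. ennreal (exp ((\<theta> - h) \<bullet> y - p y)) \<partial>lborel)
      \<le> (\<integral>\<^sup>+y. ennreal (exp (c / 2)) * ennreal (exp (\<theta> \<bullet> y - p y)) \<partial>lborel)\<^sup>2"
  proof (rule prekopa_leindler_midpoint)
    fix x y :: 'a
    define m z where "m = (1/2) *\<^sub>R (x + y)" and "z = (1/2) *\<^sub>R (x - y)"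
    have x: "x = m + z" and y: "y = m - z"
      by (simp_all add: m_def z_def algebra_simps flip: scaleR_add_left)
    have "(\<theta> + h) \<bullet> x - p x + ((\<theta> - h) \<bullet> y - p y) \<le> 2 * (c / 2 + (\<theta> \<bullet> m - p m))"
      using c[of z m] by (simp add: x y second_diff_def inner_add_left inner_add_right inner_diff_left inner_diff_right)
    then have "exp ((\<theta> + h) \<bullet> x - p x + ((\<theta> - h) \<bullet> y - p y)) \<le> (exp (c / 2 + (\<theta> \<bullet> m - p m)))\<^sup>2"
      by (simp add: exp_double[symmetric])
    then have "ennreal (exp ((\<theta> + h) \<bullet> x - p x) * exp ((\<theta> - h) \<bullet> y - p y))
        \<le> ennreal ((exp (c / 2) * exp (\<theta> \<bullet> m - p m))\<^sup>2)"
      by (intro ennreal_leI) (simp add: exp_add)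
    then show "ennreal (exp ((\<theta> + h) \<bullet> x - p x)) * ennreal (exp ((\<theta> - h) \<bullet> y - p y))
        \<le> (ennreal (exp (c / 2)) * ennreal (exp (\<theta> \<bullet> (1/2) *\<^sub>R (x + y) - p ((1/2) *\<^sub>R (x + y)))))\<^sup>2"
      unfolding m_def[symmetric] by (simp add: ennreal_mult ennreal_power[symmetric])
  qed measurable
  then have "ennreal (laplace p (\<theta> + h) * laplace p (\<theta> - h)) \<le> ennreal ((exp (c / 2) * laplace p \<theta>)\<^sup>2)"
    using laplace_pos[OF p]
    by (simp add: nn_integral_cmult nn ennreal_mult less_imp_le ennreal_power[symmetric])
  then have "laplace p (\<theta> + h) * laplace p (\<theta> - h) \<le> (exp (c / 2) * laplace p \<theta>)\<^sup>2"
    by (subst (asm) ennreal_le_iff) auto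
  then have "exp (log_laplace p (\<theta> + h) + log_laplace p (\<theta> - h)) \<le> exp (2 * (c / 2 + log_laplace p \<theta>))"
    unfolding exp_double by (simp add: exp_add exp_log_laplace[OF p])
  then have "log_laplace p (\<theta> + h) + log_laplace p (\<theta> - h) \<le> 2 * (c / 2 + log_laplace p \<theta>)"
    by (simp only: exp_le_cancel_iff)
  then show ?thesis by (simp add: second_diff_def)
qed

text \<open>
  The convex conjugate of a quadratic form is the form of the inverse matrix, and the
  supremum is attained at \<open>z = A^-1 h\<close>.
\<close>

lemma posdef_quadratic_legendre:
  fixes A :: "real^'n^'n"
  assumes "posdef A"
  shows "2 * (h \<bullet> z) - h \<bullet> (matrix_inv A *v h) \<le> z \<bullet> (A *v z)"
    "2 * (h \<bullet> (matrix_inv A *v h)) - (matrix_inv A *v h) \<bullet> (A *v (matrix_inv A *v h)) = h \<bullet> (matrix_inv A *v h)"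
proof -
  have inv: "invertible A" and sym: "transpose A = A" and psd: "psd A"
    using assms by (auto intro: posdef_imp_invertible posdef_imp_psd simp: posdef_def)
  define k where "k = matrix_inv A *v h"
  have Ak: "A *v k = h" by (simp add: k_def matrix_vector_mul_assoc matrix_inv_cancel[OF inv])
  show "2 * (h \<bullet> (matrix_inv A *v h)) - (matrix_inv A *v h) \<bullet> (A *v (matrix_inv A *v h)) = h \<bullet> (matrix_inv A *v h)"
    by (simp add: Ak inner_commute flip: k_def)
  have kz: "k \<bullet> (A *v z) = h \<bullet> z" using symmetric_inner_swap[OF sym, of k z] Ak by simp
  have "0 \<le> (z - k) \<bullet> (A *v (z - k))" using psd by (simp add: psd_def)
  also have "\<dots> = z \<bullet> (A *v z) - 2 * (h \<bullet> z) + h \<bullet> k"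
    using kz by (simp add: matrix_vector_mult_diff_distrib Ak inner_diff_left inner_diff_right inner_commute)
  finally show "2 * (h \<bullet> z) - h \<bullet> (matrix_inv A *v h) \<le> z \<bullet> (A *v z)" by (simp add: k_def)
qed

corollary log_laplace_curvature_le:
  fixes A :: "real^'n^'n"
  assumes p: "laplace_finite p" and A: "posdef A" and c: "\<And>m z. z \<bullet> (A *v z) \<le> second_diff p m z"
  shows "second_diff (log_laplace p) \<theta> h \<le> h \<bullet> (matrix_inv A *v h)"
  by (rule second_diff_log_laplace_le[OF p]) (rule order_trans[OF posdef_quadratic_legendre(1)[OF A] c])

corollary log_laplace_curvature_ge:
  fixes A :: "real^'n^'n"
  assumes p: "laplace_finite p" and A: "posdef A" and c: "\<And>m z. second_diff p m z \<le> z \<bullet> (A *v z)"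
  shows "h \<bullet> (matrix_inv A *v h) \<le> second_diff (log_laplace p) \<theta> h"
  using second_diff_log_laplace_ge[OF p c, of h "matrix_inv A *v h" \<theta>] posdef_quadratic_legendre(2)[OF A, of h] by simp

lemma log_laplace_midpoint_convex:
  assumes "laplace_finite p"
  shows "0 \<le> second_diff (log_laplace p) \<theta> h"
  using second_diff_log_laplace_ge[OF assms, of 0 0 h \<theta>] by (simp add: second_diff_def)

section \<open>Two coupled log-Laplace transforms\<close>

lemma matrix_inv_scaleR:
  fixes A :: "real^'n^'n"
  assumes "k \<noteq> 0" "invertible A"
  shows "matrix_inv (k *\<^sub>R A) = (1 / k) *\<^sub>R matrix_inv A"
  by (rule matrix_inv_eqI)
    (use assms matrix_inv_cancel(1)[OF assms(2)] in \<open>simp add: matrix_scalar_ac scalar_matrix_assoc\<close>)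

lemma posdef_scaleR: "k > 0 \<Longrightarrow> posdef A \<Longrightarrow> posdef (k *\<^sub>R A)"
  by (simp add: posdef_def transpose_scalar scaleR_matrix_vector_assoc[symmetric])

text \<open>
  If the curvature of \<open>log_laplace q\<close> is at least \<open>k T\<close> with \<open>0 \<le> k \<le> 1\<close>, then the equation for \<open>S\<close> and the bound
  \<open>v^-1 \<ge> \<delta> S^-1\<close> show that the curvature of \<open>p\<close> is at least \<open>k' S^-1\<close> with \<open>k' = k + (1 - k) \<delta>\<close>. Hence that of
  \<open>log_laplace p\<close> is at most \<open>S / k'\<close>, that of \<open>q\<close> at most \<open>T^-1 / k'\<close> because \<open>k' \<le> 1\<close>, and that of
  \<open>log_laplace q\<close> is at least \<open>k' T\<close>. The gap \<open>1 - k\<close> shrinks by the factor \<open>1 - \<delta>\<close> in each round, and the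
  first round may start from \<open>k = 0\<close>, which is convexity. Taking \<open>S\<close> and \<open>T\<close> as given turns the iteration of matrices
  into this iteration of the scalar \<open>k\<close>.
\<close>

theorem coupled_log_laplace_curvature:
  fixes u v S T X :: "real^'n^'n"
  assumes p: "laplace_finite p" and q: "laplace_finite q"
    and p_eq: "\<And>y. p y = V y + log_laplace q (transpose X *v y) + c"
    and q_eq: "\<And>x. q x = U x + log_laplace p (X *v x) + d"
    and pos: "posdef u" "posdef v" "posdef S" "posdef T"
    and S: "matrix_inv S = matrix_inv v + X ** T ** transpose X"
    and T: "matrix_inv T = matrix_inv u + transpose X ** S ** X"
    and U: "\<And>m z. second_diff U m z \<le> z \<bullet> (matrix_inv u *v z)"
    and V: "\<And>m z. z \<bullet> (matrix_inv v *v z) \<le> second_diff V m z"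
  shows "second_diff (log_laplace p) \<theta> h \<le> h \<bullet> (S *v h)"
    and "h \<bullet> (T *v h) \<le> second_diff (log_laplace q) \<theta> h"
proof -
  have Si: "posdef (matrix_inv S)" and Ti: "posdef (matrix_inv T)" using pos by (auto intro: posdef_matrix_inv)
  have inv: "invertible S" "invertible T" "invertible (matrix_inv S)" "invertible (matrix_inv T)"
    using pos by (auto intro: posdef_imp_invertible invertible_matrix_inv)
  have quadS: "z \<bullet> (matrix_inv S *v z)
      = z \<bullet> (matrix_inv v *v z) + (transpose X *v z) \<bullet> (T *v (transpose X *v z))" for z
    using inner_transpose_mult[of z "transpose X"]
    by (simp add: S matrix_vector_mult_add_rdistrib inner_add_right flip: matrix_vector_mul_assoc)
  have quadT: "z \<bullet> (matrix_inv T *v z) = z \<bullet> (matrix_inv u *v z) + (X *v z) \<bullet> (S *v (X *v z))" for z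
    by (simp add: T matrix_vector_mult_add_rdistrib inner_add_right inner_transpose_mult
        del: transpose_matrix_vector flip: matrix_vector_mul_assoc)
  have Dp: "second_diff p m z = second_diff V m z + second_diff (log_laplace q) (transpose X *v m) (transpose X *v z)" for m z
    by (simp add: second_diff_def p_eq matrix_vector_right_distrib matrix_vector_mult_diff_distrib
        del: transpose_matrix_vector)
  have Dq: "second_diff q m z = second_diff U m z + second_diff (log_laplace p) (X *v m) (X *v z)" for m z
    by (simp add: second_diff_def q_eq matrix_vector_right_distrib matrix_vector_mult_diff_distrib)
  obtain \<delta> where \<delta>: "0 < \<delta>" "\<delta> \<le> 1" "\<And>z. \<delta> * (z \<bullet> (matrix_inv S *v z)) \<le> z \<bullet> (matrix_inv v *v z)"
    using posdef_dominates_small_multiple[OF posdef_matrix_inv[OF pos(2)]] by metis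
  \<comment> \<open>Half a round: a lower bound for \<open>log_laplace q\<close> gives an upper bound for \<open>log_laplace p\<close>.\<close>
  have half_step: "second_diff (log_laplace p) \<theta> h \<le> (1 / k') * (h \<bullet> (S *v h))"
    if k: "0 \<le> k" "k \<le> 1" "k' = k + (1 - k) * \<delta>" "k' > 0"
      and lower: "\<And>\<theta> h. k * (h \<bullet> (T *v h)) \<le> second_diff (log_laplace q) \<theta> h" for k k' \<theta> h
  proof -
    have "z \<bullet> ((k' *\<^sub>R matrix_inv S) *v z) \<le> second_diff p m z" for m z
    proof -
      have "z \<bullet> ((k' *\<^sub>R matrix_inv S) *v z)
          = k * (z \<bullet> (matrix_inv S *v z)) + (1 - k) * (\<delta> * (z \<bullet> (matrix_inv S *v z)))"
        by (simp add: k(3) scaleR_matrix_vector_assoc[symmetric] algebra_simps)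
      also have "\<dots> \<le> k * (z \<bullet> (matrix_inv S *v z)) + (1 - k) * (z \<bullet> (matrix_inv v *v z))"
        using k \<delta>(3)[of z] by (intro add_left_mono mult_left_mono) auto
      also have "\<dots> = z \<bullet> (matrix_inv v *v z) + k * ((transpose X *v z) \<bullet> (T *v (transpose X *v z)))"
        unfolding quadS by (simp add: algebra_simps)
      also have "\<dots> \<le> second_diff p m z" unfolding Dp by (intro add_mono V lower)
      finally show ?thesis .
    qed
    from log_laplace_curvature_le[OF p posdef_scaleR[OF k(4) Si] this] show ?thesis
      using k(4) inv by (simp add: matrix_inv_scaleR matrix_inv_matrix_inv scaleR_matrix_vector_assoc[symmetric])
  qed
  \<comment> \<open>The closed form of the recursion \<open>k \<mapsto> k + (1 - k) \<delta>\<close> started at \<open>0\<close>.\<close>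
  define k where "k n = 1 - (1 - \<delta>) ^ n" for n
  have k01: "0 \<le> k n" "k n \<le> 1" for n using \<delta> by (auto simp: k_def power_le_one)
  have lower: "k n * (h \<bullet> (T *v h)) \<le> second_diff (log_laplace q) \<theta> h" for n \<theta> h
  proof (induction n arbitrary: \<theta> h)
    case 0
    then show ?case using log_laplace_midpoint_convex[OF q] by (simp add: k_def)
  next
    case (Suc n)
    have kS: "k (Suc n) = k n + (1 - k n) * \<delta>" by (simp add: k_def algebra_simps)
    have "(1 - \<delta>) ^ Suc n \<le> (1 - \<delta>) ^ 1" using \<delta> by (intro power_decreasing) auto
    then have kpos: "k (Suc n) > 0" using \<delta>(1) by (simp add: k_def)
    have "second_diff q m z \<le> z \<bullet> (((1 / k (Suc n)) *\<^sub>R matrix_inv T) *v z)" for m z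
    proof -
      have "z \<bullet> (matrix_inv u *v z) \<le> (1 / k (Suc n)) * (z \<bullet> (matrix_inv u *v z))"
        using kpos k01(2)[of "Suc n"] posdef_imp_psd[OF posdef_matrix_inv[OF pos(1)]]
          mult_right_mono[of 1 "1 / k (Suc n)" "z \<bullet> (matrix_inv u *v z)"]
        by (simp add: psd_def)
      then have "second_diff q m z
          \<le> (1 / k (Suc n)) * (z \<bullet> (matrix_inv u *v z)) + (1 / k (Suc n)) * ((X *v z) \<bullet> (S *v (X *v z)))"
        unfolding Dq
        using U[of m z] half_step[OF k01 kS kpos Suc.IH, of "X *v m" "X *v z"] by linarith
      also have "\<dots> = z \<bullet> (((1 / k (Suc n)) *\<^sub>R matrix_inv T) *v z)"
        by (simp add: scaleR_matrix_vector_assoc[symmetric] quadT distrib_left del: times_divide_eq_left)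
      finally show ?thesis .
    qed
    from log_laplace_curvature_ge[OF q posdef_scaleR[OF _ Ti] this, of h \<theta>] show ?case
      using kpos inv by (simp add: matrix_inv_scaleR matrix_inv_matrix_inv scaleR_matrix_vector_assoc[symmetric])
  qed
  have lim: "(\<lambda>n. k n * a) \<longlonglongrightarrow> (1 - 0) * a" for a
    unfolding k_def using \<delta> by (intro tendsto_intros LIMSEQ_power_zero) auto
  have T_lower: "h \<bullet> (T *v h) \<le> second_diff (log_laplace q) \<theta> h" for \<theta> h
    using LIMSEQ_le_const2[OF lim[of "h \<bullet> (T *v h)"]] lower by auto
  then show "h \<bullet> (T *v h) \<le> second_diff (log_laplace q) \<theta> h" .
  show "second_diff (log_laplace p) \<theta> h \<le> h \<bullet> (S *v h)"
    using half_step[of 1 1] T_lower by simp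
qed

section \<open>Mean and covariance of an exponential family\<close>

text \<open>
  Some coordinate satisfies \<open>norm y \<le> DIM('a) * \<bar>y \<bullet> b\<bar>\<close>, so that finitely many Laplace
  transforms control every integrand of exponential growth. The summand 1 covers \<open>k \<le> 0\<close>.
\<close>

lemma exp_norm_le_sum_exp:
  fixes y :: "'a::euclidean_space"
  shows "exp (k * norm y) \<le> (\<Sum>b\<in>Basis. exp ((k * DIM('a)) *\<^sub>R b \<bullet> y) + exp (- ((k * DIM('a)) *\<^sub>R b) \<bullet> y)) + 1"
proof (cases "k \<le> 0")
  case True
  then have "exp (k * norm y) \<le> 1" by (simp add: mult_nonpos_nonneg)
  moreover have "0 \<le> (\<Sum>b\<in>Basis. exp ((k * DIM('a)) *\<^sub>R b \<bullet> y) + exp (- ((k * DIM('a)) *\<^sub>R b) \<bullet> y))"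
    by (intro sum_nonneg) (simp add: add_nonneg_nonneg)
  ultimately show ?thesis by linarith
next
  case False
  obtain b :: 'a where b: "b \<in> Basis" "\<And>c. c \<in> Basis \<Longrightarrow> \<bar>y \<bullet> c\<bar> \<le> \<bar>y \<bullet> b\<bar>"
  proof -
    have "Max ((\<lambda>c. \<bar>y \<bullet> c\<bar>) ` Basis) \<in> (\<lambda>c. \<bar>y \<bullet> c\<bar>) ` Basis" by (intro Max_in) auto
    then obtain b where "Max ((\<lambda>c. \<bar>y \<bullet> c\<bar>) ` Basis) = \<bar>y \<bullet> b\<bar>" "b \<in> Basis" by (rule imageE)
    then show thesis using Max_ge[of "(\<lambda>c. \<bar>y \<bullet> c\<bar>) ` Basis"] by (intro that[of b]) auto
  qed
  have "norm y \<le> (\<Sum>c\<in>Basis. \<bar>y \<bullet> c\<bar>)" by (rule norm_le_l1)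
  also have "\<dots> \<le> DIM('a) * \<bar>y \<bullet> b\<bar>" using b(2) by (intro sum_bounded_above)
  finally have "exp (k * norm y) \<le> exp (\<bar>k * DIM('a) * (b \<bullet> y)\<bar>)"
    using False by (simp add: abs_mult inner_commute)
  also have "\<dots> \<le> exp ((k * DIM('a)) *\<^sub>R b \<bullet> y) + exp (- ((k * DIM('a)) *\<^sub>R b) \<bullet> y)"
    by (cases "0 \<le> k * DIM('a) * (b \<bullet> y)") (auto simp: abs_if)
  also have "\<dots> \<le> (\<Sum>b\<in>Basis. exp ((k * DIM('a)) *\<^sub>R b \<bullet> y) + exp (- ((k * DIM('a)) *\<^sub>R b) \<bullet> y))"
    using b(1) by (intro member_le_sum) (auto simp: add_nonneg_nonneg)
  finally show ?thesis by simp
qed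

lemma laplace_finite_integrable:
  fixes q :: "'a::euclidean_space \<Rightarrow> 'b::{banach,second_countable_topology}"
  assumes p: "laplace_finite p" and [measurable]: "q \<in> borel_measurable borel"
    and bound: "\<And>y. norm (q y) \<le> C * exp (k * norm y)"
  shows "integrable lborel (\<lambda>y. exp (\<theta> \<bullet> y - p y) *\<^sub>R q y)"
proof -
  have [measurable]: "p \<in> borel_measurable borel" using p by measurable
  have int: "integrable lborel (\<lambda>y. exp (\<theta> \<bullet> y - p y))" for \<theta> using p by (simp add: laplace_finite_def)
  let ?e = "\<lambda>y. (\<Sum>b\<in>Basis. exp ((k * DIM('a)) *\<^sub>R b \<bullet> y) + exp (- ((k * DIM('a)) *\<^sub>R b) \<bullet> y)) + 1"
  have "integrable lborel (\<lambda>y. \<bar>C\<bar> * ((\<Sum>b\<in>Basis. exp ((\<theta> + (k * DIM('a)) *\<^sub>R b) \<bullet> y - p y)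
      + exp ((\<theta> + - ((k * DIM('a)) *\<^sub>R b)) \<bullet> y - p y)) + exp (\<theta> \<bullet> y - p y)))"
    by (intro integrable_mult_right Bochner_Integration.integrable_add Bochner_Integration.integrable_sum int)
  also have "(\<lambda>y. \<bar>C\<bar> * ((\<Sum>b\<in>Basis. exp ((\<theta> + (k * DIM('a)) *\<^sub>R b) \<bullet> y - p y)
      + exp ((\<theta> + - ((k * DIM('a)) *\<^sub>R b)) \<bullet> y - p y)) + exp (\<theta> \<bullet> y - p y)))
      = (\<lambda>y. exp (\<theta> \<bullet> y - p y) * (\<bar>C\<bar> * ?e y))"
    by (rule ext) (simp only: inner_add_left exp_diff exp_add distrib_left distrib_right sum_distrib_left
        sum_distrib_right mult_ac divide_inverse mult_1_right mult_1_left)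
  finally show ?thesis
  proof (rule Bochner_Integration.integrable_bound)
    show "AE y in lborel. norm (exp (\<theta> \<bullet> y - p y) *\<^sub>R q y) \<le> norm (exp (\<theta> \<bullet> y - p y) * (\<bar>C\<bar> * ?e y))"
    proof (rule AE_I2)
      fix y :: 'a
      have "norm (q y) \<le> \<bar>C\<bar> * exp (k * norm y)"
        using bound[of y] by (rule order_trans) (simp add: mult_right_mono)
      also have "\<dots> \<le> \<bar>C\<bar> * ?e y" by (intro mult_left_mono exp_norm_le_sum_exp) auto
      finally have "norm (q y) \<le> \<bar>\<bar>C\<bar> * ?e y\<bar>" by linarith
      then show "norm (exp (\<theta> \<bullet> y - p y) *\<^sub>R q y) \<le> norm (exp (\<theta> \<bullet> y - p y) * (\<bar>C\<bar> * ?e y))"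
        by (simp add: abs_mult mult_left_mono)
    qed
  qed measurable
qed

lemma exp_remainder_bound:
  fixes t :: real
  shows "\<bar>exp t - 1 - t\<bar> \<le> t\<^sup>2 * exp \<bar>t\<bar>"
proof -
  obtain s where s: "\<bar>s\<bar> \<le> \<bar>t\<bar>" "exp t = (\<Sum>m<2. t ^ m / fact m) + exp s / fact 2 * t ^ 2"
    using Maclaurin_exp_le[of t 2] by auto
  have "exp t - 1 - t = exp s / 2 * t\<^sup>2" using s(2) by (simp add: numeral_2_eq_2)
  then have "\<bar>exp t - 1 - t\<bar> = exp s / 2 * t\<^sup>2" by (simp only:) (simp add: abs_mult)
  also have "\<dots> \<le> exp \<bar>t\<bar> * t\<^sup>2"
  proof (rule mult_right_mono)
    have "exp s \<le> exp \<bar>t\<bar>" using s(1) by simp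
    then show "exp s / 2 \<le> exp \<bar>t\<bar>" using exp_gt_zero[of s] by linarith
  qed simp
  finally show ?thesis by (simp add: mult.commute)
qed

lemma has_derivative_quadratic_remainder:
  fixes G :: "'a::real_normed_vector \<Rightarrow> 'b::real_normed_vector"
  assumes L: "bounded_linear L" and K: "\<And>h. norm h \<le> 1 \<Longrightarrow> norm (G (x + h) - G x - L h) \<le> K * (norm h)\<^sup>2"
  shows "(G has_derivative L) (at x)"
  unfolding has_derivative_at
proof
  show "(\<lambda>h. norm (G (x + h) - G x - L h) / norm h) \<midarrow>0\<rightarrow> 0"
  proof (rule tendsto_sandwich[of "\<lambda>_. 0" _ _ "\<lambda>h. K * norm h"])
    have "eventually (\<lambda>h::'a. norm h < 1) (at 0)"
      unfolding eventually_at by (auto intro!: exI[of _ 1])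
    then show "\<forall>\<^sub>F h in at 0. norm (G (x + h) - G x - L h) / norm h \<le> K * norm h"
    proof eventually_elim
      case (elim h)
      then show ?case using K[of h] by (cases "h = 0") (auto simp: divide_le_eq power2_eq_square mult_ac)
    qed
    have "((\<lambda>h::'a. K * norm h) \<longlongrightarrow> K * norm (0::'a)) (at 0)" by (intro tendsto_intros)
    then show "((\<lambda>h::'a. K * norm h) \<longlongrightarrow> 0) (at 0)" by simp
  qed auto
qed (rule L)

text \<open>
  Second-order Taylor expansion of \<open>exp (h \<bullet> y)\<close> leaves a remainder of at most \<open>(norm h)^2\<close>
  times a fixed integrable function for all \<open>norm h \<le> 1\<close>.
\<close>

theorem has_derivative_laplace_integral:
  fixes q :: "'a::euclidean_space \<Rightarrow> 'b::{banach,second_countable_topology}"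
  assumes p: "laplace_finite p" and [measurable]: "q \<in> borel_measurable borel"
    and C: "C \<ge> 0" and bound: "\<And>y. norm (q y) \<le> C * exp (norm y)"
  shows "((\<lambda>\<theta>. \<integral>y. exp (\<theta> \<bullet> y - p y) *\<^sub>R q y \<partial>lborel) has_derivative
    (\<lambda>h. \<integral>y. exp (\<theta> \<bullet> y - p y) *\<^sub>R ((h \<bullet> y) *\<^sub>R q y) \<partial>lborel)) (at \<theta>)"
proof (rule has_derivative_quadratic_remainder)
  have [measurable]: "p \<in> borel_measurable borel" using p by measurable
  have le_exp: "norm y \<le> exp (norm y)" for y :: 'a using exp_ge_add_one_self[of "norm y"] by linarith
  have int0: "integrable lborel (\<lambda>y. exp (\<theta> \<bullet> y - p y) *\<^sub>R q y)" for \<theta>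
    by (rule laplace_finite_integrable[OF p, of q C 1]) (use bound in auto)
  have int1: "integrable lborel (\<lambda>y. exp (\<theta> \<bullet> y - p y) *\<^sub>R ((h \<bullet> y) *\<^sub>R q y))" for h
  proof (rule laplace_finite_integrable[OF p, of _ "norm h * C" 2])
    fix y
    have "norm ((h \<bullet> y) *\<^sub>R q y) \<le> (norm h * exp (norm y)) * (C * exp (norm y))"
      unfolding norm_scaleR real_norm_def
      using order_trans[OF Cauchy_Schwarz_ineq2[of h y] mult_left_mono[OF le_exp[of y] norm_ge_zero[of h]]]
      by (intro mult_mono bound) auto
    then show "norm ((h \<bullet> y) *\<^sub>R q y) \<le> norm h * C * exp (2 * norm y)"
      unfolding exp_double power2_eq_square by (simp only: mult_ac)
  qed measurable
  define K where "K = (\<integral>y. exp (\<theta> \<bullet> y - p y) *\<^sub>R ((norm y)\<^sup>2 * exp (norm y) * norm (q y)) \<partial>lborel)"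
  have int2: "integrable lborel (\<lambda>y. exp (\<theta> \<bullet> y - p y) *\<^sub>R ((norm y)\<^sup>2 * exp (norm y) * norm (q y)))"
  proof (rule laplace_finite_integrable[OF p, of _ "C" 4])
    fix y
    have "(norm y)\<^sup>2 * exp (norm y) * norm (q y) \<le> (exp (norm y))\<^sup>2 * exp (norm y) * (C * exp (norm y))"
      using le_exp[of y] by (intro mult_mono power_mono bound) auto
    also have "\<dots> = C * exp (4 * norm y)"
      using exp_of_nat_mult[of 4 "norm y"] by (simp add: power2_eq_square power4_eq_xxxx mult_ac)
    finally show "norm ((norm y)\<^sup>2 * exp (norm y) * norm (q y)) \<le> C * exp (4 * norm y)" by simp
  qed measurable
  show "bounded_linear (\<lambda>h. \<integral>y. exp (\<theta> \<bullet> y - p y) *\<^sub>R ((h \<bullet> y) *\<^sub>R q y) \<partial>lborel)"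
    unfolding linear_conv_bounded_linear[symmetric]
  proof (rule linearI)
    fix h k and r :: real
    show "(\<integral>y. exp (\<theta> \<bullet> y - p y) *\<^sub>R (((h + k) \<bullet> y) *\<^sub>R q y) \<partial>lborel)
        = (\<integral>y. exp (\<theta> \<bullet> y - p y) *\<^sub>R ((h \<bullet> y) *\<^sub>R q y) \<partial>lborel)
        + (\<integral>y. exp (\<theta> \<bullet> y - p y) *\<^sub>R ((k \<bullet> y) *\<^sub>R q y) \<partial>lborel)"
      using int1 by (simp add: inner_add_left scaleR_add_left scaleR_add_right)
    have "(\<integral>y. exp (\<theta> \<bullet> y - p y) *\<^sub>R (((r *\<^sub>R h) \<bullet> y) *\<^sub>R q y) \<partial>lborel)
        = (\<integral>y. r *\<^sub>R (exp (\<theta> \<bullet> y - p y) *\<^sub>R ((h \<bullet> y) *\<^sub>R q y)) \<partial>lborel)"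
      by (intro Bochner_Integration.integral_cong) (simp_all add: mult_ac)
    then show "(\<integral>y. exp (\<theta> \<bullet> y - p y) *\<^sub>R (((r *\<^sub>R h) \<bullet> y) *\<^sub>R q y) \<partial>lborel)
        = r *\<^sub>R (\<integral>y. exp (\<theta> \<bullet> y - p y) *\<^sub>R ((h \<bullet> y) *\<^sub>R q y) \<partial>lborel)"
      by (simp only: integral_scaleR_right)
  qed
  fix h :: 'a assume h: "norm h \<le> 1"
  have "norm ((\<integral>y. exp ((\<theta> + h) \<bullet> y - p y) *\<^sub>R q y \<partial>lborel) - (\<integral>y. exp (\<theta> \<bullet> y - p y) *\<^sub>R q y \<partial>lborel)
        - (\<integral>y. exp (\<theta> \<bullet> y - p y) *\<^sub>R ((h \<bullet> y) *\<^sub>R q y) \<partial>lborel))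
      = norm (\<integral>y. exp ((\<theta> + h) \<bullet> y - p y) *\<^sub>R q y - exp (\<theta> \<bullet> y - p y) *\<^sub>R q y
          - exp (\<theta> \<bullet> y - p y) *\<^sub>R ((h \<bullet> y) *\<^sub>R q y) \<partial>lborel)"
    using int0 int1 by simp
  also have "\<dots> \<le> (\<integral>y. (norm h)\<^sup>2 * (exp (\<theta> \<bullet> y - p y) *\<^sub>R ((norm y)\<^sup>2 * exp (norm y) * norm (q y))) \<partial>lborel)"
  proof (rule Bochner_Integration.integral_norm_bound_integral)
    fix y :: 'a
    have hy: "\<bar>h \<bullet> y\<bar> \<le> norm h * norm y" by (rule Cauchy_Schwarz_ineq2)
    have "norm h * norm y \<le> norm y" using h by (simp add: mult_left_le_one_le)
    have "\<bar>exp (h \<bullet> y) - 1 - h \<bullet> y\<bar> \<le> (h \<bullet> y)\<^sup>2 * exp \<bar>h \<bullet> y\<bar>" by (rule exp_remainder_bound)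
    also have "\<dots> \<le> (norm h * norm y)\<^sup>2 * exp (norm y)"
      using hy \<open>norm h * norm y \<le> norm y\<close> by (intro mult_mono) (auto simp: abs_le_square_iff[symmetric])
    finally have rem: "\<bar>exp (h \<bullet> y) - 1 - h \<bullet> y\<bar> \<le> (norm h)\<^sup>2 * (norm y)\<^sup>2 * exp (norm y)"
      by (simp add: power_mult_distrib)
    have "exp ((\<theta> + h) \<bullet> y - p y) *\<^sub>R q y - exp (\<theta> \<bullet> y - p y) *\<^sub>R q y
          - exp (\<theta> \<bullet> y - p y) *\<^sub>R ((h \<bullet> y) *\<^sub>R q y)
        = (exp (\<theta> \<bullet> y - p y) * (exp (h \<bullet> y) - 1 - h \<bullet> y)) *\<^sub>R q y"
    proof -
      have "exp ((\<theta> + h) \<bullet> y - p y) = exp (\<theta> \<bullet> y - p y) * exp (h \<bullet> y)"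
        by (simp add: inner_add_left flip: exp_add)
      then show ?thesis by (simp add: right_diff_distrib scaleR_diff_left)
    qed
    then have "norm (exp ((\<theta> + h) \<bullet> y - p y) *\<^sub>R q y - exp (\<theta> \<bullet> y - p y) *\<^sub>R q y
          - exp (\<theta> \<bullet> y - p y) *\<^sub>R ((h \<bullet> y) *\<^sub>R q y))
        = exp (\<theta> \<bullet> y - p y) * \<bar>exp (h \<bullet> y) - 1 - h \<bullet> y\<bar> * norm (q y)"
      by (simp add: abs_mult)
    also have "\<dots> \<le> exp (\<theta> \<bullet> y - p y) * ((norm h)\<^sup>2 * (norm y)\<^sup>2 * exp (norm y)) * norm (q y)"
      by (intro mult_right_mono mult_left_mono rem) auto
    finally show "norm (exp ((\<theta> + h) \<bullet> y - p y) *\<^sub>R q y - exp (\<theta> \<bullet> y - p y) *\<^sub>R q y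
          - exp (\<theta> \<bullet> y - p y) *\<^sub>R ((h \<bullet> y) *\<^sub>R q y))
        \<le> (norm h)\<^sup>2 * (exp (\<theta> \<bullet> y - p y) *\<^sub>R ((norm y)\<^sup>2 * exp (norm y) * norm (q y)))"
      by (simp add: mult_ac)
  qed (use int0 int1 int2 in auto)
  also have "\<dots> = K * (norm h)\<^sup>2" by (simp add: K_def)
  finally show "norm ((\<integral>y. exp ((\<theta> + h) \<bullet> y - p y) *\<^sub>R q y \<partial>lborel) - (\<integral>y. exp (\<theta> \<bullet> y - p y) *\<^sub>R q y \<partial>lborel)
        - (\<integral>y. exp (\<theta> \<bullet> y - p y) *\<^sub>R ((h \<bullet> y) *\<^sub>R q y) \<partial>lborel)) \<le> K * (norm h)\<^sup>2" .
qed

text \<open>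
  The member of the exponential family generated by \<open>exp (- p)\<close> with parameter \<open>\<theta>\<close>. It is written
  through its potential, since this is how the transitions of the bridge are given.
\<close>

definition tilted :: "(real^'n \<Rightarrow> real) \<Rightarrow> real^'n \<Rightarrow> (real^'n) measure" where
  "tilted p \<theta> = pot_measure (\<lambda>y. log_laplace p \<theta> + p y - \<theta> \<bullet> y)"

lemma sets_tilted [simp, measurable_cong]: "sets (tilted p \<theta>) = sets borel"
  by (simp add: tilted_def pot_measure_def)

lemma space_tilted [simp]: "space (tilted p \<theta>) = UNIV"
  by (simp add: tilted_def pot_measure_def)

lemma tilted_density:
  assumes "laplace_finite p"
  shows "exp (- (log_laplace p \<theta> + p y - \<theta> \<bullet> y)) = exp (\<theta> \<bullet> y - p y) / laplace p \<theta>"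
  by (simp add: exp_log_laplace[OF assms, symmetric] flip: exp_diff)

lemma integrable_tilted:
  fixes q :: "real^'n \<Rightarrow> 'b::{banach,second_countable_topology}"
  assumes p: "laplace_finite p" and [measurable]: "q \<in> borel_measurable borel"
    and bound: "\<And>y. norm (q y) \<le> C * exp (k * norm y)"
  shows "integrable (tilted p \<theta>) q"
proof -
  have [measurable]: "p \<in> borel_measurable borel" using p by measurable
  have "integrable lborel (\<lambda>y. (1 / laplace p \<theta>) *\<^sub>R (exp (\<theta> \<bullet> y - p y) *\<^sub>R q y))"
    by (intro integrable_scaleR_right laplace_finite_integrable[OF p _ bound]) measurable
  then show ?thesis
    unfolding tilted_def pot_measure_def
    by (subst integrable_density) (simp_all add: tilted_density[OF p, simplified] divide_inverse mult.commute
      less_imp_le[OF laplace_pos[OF p]])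
qed

lemma integral_tilted:
  fixes q :: "real^'n \<Rightarrow> 'b::{banach,second_countable_topology}"
  assumes p: "laplace_finite p" and [measurable]: "q \<in> borel_measurable borel"
  shows "(\<integral>y. q y \<partial>tilted p \<theta>) = (1 / laplace p \<theta>) *\<^sub>R (\<integral>y. exp (\<theta> \<bullet> y - p y) *\<^sub>R q y \<partial>lborel)"
proof -
  have [measurable]: "p \<in> borel_measurable borel" using p by measurable
  have "(\<integral>y. q y \<partial>tilted p \<theta>)
      = (\<integral>y. (1 / laplace p \<theta>) *\<^sub>R (exp (\<theta> \<bullet> y - p y) *\<^sub>R q y) \<partial>lborel)"
    unfolding tilted_def pot_measure_def
    by (subst integral_density) (simp_all add: tilted_density[OF p, simplified] divide_inverse mult.commute
      less_imp_le[OF laplace_pos[OF p]])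
  then show ?thesis by (simp only: integral_scaleR_right)
qed

lemma integral_tilted_const:
  assumes p: "laplace_finite p"
  shows "(\<integral>y. c \<partial>tilted p \<theta>) = (c :: real)"
  using laplace_pos[OF p, of \<theta>]
  by (subst integral_tilted[OF p]) (simp_all add: laplace_def)

text \<open>
  The cumulants of an exponential family. The mean is the quotient of the integral of \<open>exp (\<theta> \<bullet> y - p y) y\<close> by
  \<open>laplace p \<theta>\<close>; the quotient rule gives \<open>E ((h \<bullet> y) y) - (h \<bullet> E y) E y\<close>, which is the covariance
  matrix applied to \<open>h\<close>.
\<close>

lemma has_derivative_mean_tilted:
  fixes p :: "real^'n \<Rightarrow> real"
  assumes p: "laplace_finite p"
  shows "(log_laplace p has_derivative (\<lambda>h. h \<bullet> mean (tilted p \<theta>))) (at \<theta>)"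
    and "((\<lambda>\<theta>. mean (tilted p \<theta>)) has_derivative (\<lambda>h. covariance (tilted p \<theta>) *v h)) (at \<theta>)"
proof -
  let ?P = "tilted p \<theta>"
  define F where "F = laplace p \<theta>"
  have F: "F > 0" unfolding F_def by (rule laplace_pos[OF p])
  have le_exp: "norm y \<le> exp (norm y)" for y :: "real^'n"
    using exp_ge_add_one_self[of "norm y"] by linarith
  have le_exp2: "\<bar>h \<bullet> y\<bar> * \<bar>y $ i\<bar> \<le> norm h * exp (2 * norm y)" for h y :: "real^'n" and i
  proof -
    have "\<bar>h \<bullet> y\<bar> * \<bar>y $ i\<bar> \<le> (norm h * exp (norm y)) * exp (norm y)"
      using order_trans[OF Cauchy_Schwarz_ineq2[of h y] mult_left_mono[OF le_exp[of y] norm_ge_zero[of h]]]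
        order_trans[OF component_le_norm_cart[of y i] le_exp[of y]]
      by (intro mult_mono) auto
    then show ?thesis unfolding exp_double power2_eq_square by (simp only: mult_ac)
  qed
  have int_y: "integrable ?P (\<lambda>y. y)"
    by (rule integrable_tilted[OF p, of _ 1 1]) (use le_exp in auto)
  have int_hy: "integrable ?P (\<lambda>y. h \<bullet> y)" for h
    using int_y by (rule integrable_inner_right)
  have int_yi: "integrable ?P (\<lambda>y. y $ i)" for i
    using int_hy[of "axis i 1"] by (simp add: inner_axis')
  have int_hyi: "integrable ?P (\<lambda>y. (h \<bullet> y) * y $ i)" for h i
    by (rule integrable_tilted[OF p, of _ "norm h" 2]) (use le_exp2 in \<open>auto simp: abs_mult\<close>)
  have int_c: "integrable ?P (\<lambda>y. c)" for c :: real
    by (rule integrable_tilted[OF p, of _ "\<bar>c\<bar>" 0]) auto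
  have int_hyy: "integrable ?P (\<lambda>y. (h \<bullet> y) *\<^sub>R y)" for h
  proof (rule integrable_tilted[OF p, of _ "norm h" 2])
    fix y
    have "norm ((h \<bullet> y) *\<^sub>R y) \<le> (norm h * exp (norm y)) * exp (norm y)"
      using order_trans[OF Cauchy_Schwarz_ineq2[of h y] mult_left_mono[OF le_exp[of y] norm_ge_zero[of h]]] le_exp[of y]
      unfolding norm_scaleR real_norm_def by (intro mult_mono) auto
    then show "norm ((h \<bullet> y) *\<^sub>R y) \<le> norm h * exp (2 * norm y)"
      unfolding exp_double power2_eq_square by (simp only: mult_ac)
  qed measurable
  have mean_eq: "mean (tilted p t) = inverse (laplace p t) *\<^sub>R (\<integral>y. exp (t \<bullet> y - p y) *\<^sub>R y \<partial>lborel)" for t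
    unfolding mean_def by (subst integral_tilted[OF p]) (simp_all add: divide_inverse)
  have dF: "(laplace p has_derivative (\<lambda>h. F * (h \<bullet> mean ?P))) (at \<theta>)"
  proof -
    have "(laplace p has_derivative (\<lambda>h. \<integral>y. exp (\<theta> \<bullet> y - p y) *\<^sub>R ((h \<bullet> y) *\<^sub>R 1) \<partial>lborel)) (at \<theta>)"
      using has_derivative_laplace_integral[OF p, of "\<lambda>_. 1 :: real" 1 \<theta>] by (simp add: laplace_def[abs_def])
    also have "(\<lambda>h. \<integral>y. exp (\<theta> \<bullet> y - p y) *\<^sub>R ((h \<bullet> y) *\<^sub>R (1::real)) \<partial>lborel) = (\<lambda>h. F * (\<integral>y. h \<bullet> y \<partial>?P))"
      using F by (subst integral_tilted[OF p]) (auto simp: F_def)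
    also have "\<dots> = (\<lambda>h. F * (h \<bullet> mean ?P))" using int_y by (simp add: mean_def)
    finally show ?thesis .
  qed
  show "(log_laplace p has_derivative (\<lambda>h. h \<bullet> mean ?P)) (at \<theta>)"
    unfolding log_laplace_def[abs_def]
  proof -
    have "(\<lambda>h. F * (h \<bullet> mean ?P) * inverse F) = (\<lambda>h. h \<bullet> mean ?P)" using F by (auto simp: field_simps)
    then show "((\<lambda>\<theta>. ln (laplace p \<theta>)) has_derivative (\<lambda>h. h \<bullet> mean ?P)) (at \<theta>)"
      using has_derivative_ln[OF _ dF] F by (simp add: F_def[symmetric])
  qed
  have dM: "((\<lambda>t. \<integral>y. exp (t \<bullet> y - p y) *\<^sub>R y \<partial>lborel) has_derivative (\<lambda>h. F *\<^sub>R (\<integral>y. (h \<bullet> y) *\<^sub>R y \<partial>?P))) (at \<theta>)"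
  proof -
    have "((\<lambda>t. \<integral>y. exp (t \<bullet> y - p y) *\<^sub>R y \<partial>lborel) has_derivative
        (\<lambda>h. \<integral>y. exp (\<theta> \<bullet> y - p y) *\<^sub>R ((h \<bullet> y) *\<^sub>R y) \<partial>lborel)) (at \<theta>)"
      using le_exp by (intro has_derivative_laplace_integral[OF p, of _ 1]) auto
    also have "(\<lambda>h. \<integral>y. exp (\<theta> \<bullet> y - p y) *\<^sub>R ((h \<bullet> y) *\<^sub>R y) \<partial>lborel) = (\<lambda>h. F *\<^sub>R (\<integral>y. (h \<bullet> y) *\<^sub>R y \<partial>?P))"
      using F by (subst integral_tilted[OF p]) (auto simp: F_def)
    finally show ?thesis .
  qed
  have cov: "covariance ?P *v h = (\<integral>y. (h \<bullet> y) *\<^sub>R y \<partial>?P) - (h \<bullet> mean ?P) *\<^sub>R mean ?P" for h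
  proof -
    define m where "m = mean ?P"
    have mi: "(\<integral>y. y $ i \<partial>?P) = m $ i" for i
      using integral_inner_right[OF int_y, of "axis i 1"] by (simp add: m_def mean_def inner_axis')
    have mh: "(\<integral>y. h \<bullet> y \<partial>?P) = h \<bullet> m" using int_y by (simp add: m_def mean_def)
    have int_ij: "integrable ?P (\<lambda>y. (y $ i - m $ i) * (y $ j - m $ j))" for i j
    proof -
      have "integrable ?P (\<lambda>y. (axis j 1 \<bullet> y) * y $ i - m $ i * y $ j - m $ j * y $ i + m $ i * m $ j)"
        by (intro Bochner_Integration.integrable_add Bochner_Integration.integrable_diff integrable_mult_right int_hyi int_yi int_c)
      then show ?thesis by (simp add: inner_axis' algebra_simps)
    qed
    show ?thesis
    proof (subst vec_eq_iff, intro allI)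
      fix i
      have "(covariance ?P *v h) $ i = (\<Sum>j\<in>UNIV. (\<integral>y. (y $ i - m $ i) * (y $ j - m $ j) \<partial>?P) * h $ j)"
        by (simp add: covariance_def matrix_vector_mult_def m_def)
      also have "\<dots> = (\<integral>y. (\<Sum>j\<in>UNIV. (y $ i - m $ i) * (y $ j - m $ j) * h $ j) \<partial>?P)"
        by (subst Bochner_Integration.integral_sum) (auto intro!: integrable_mult_left int_ij)
      also have "(\<lambda>y. \<Sum>j\<in>UNIV. (y $ i - m $ i) * (y $ j - m $ j) * h $ j)
          = (\<lambda>y. (h \<bullet> y) * y $ i - m $ i * (h \<bullet> y) - (h \<bullet> m) * y $ i + m $ i * (h \<bullet> m))"
      proof
        fix y
        have "(\<Sum>j\<in>UNIV. (y $ i - m $ i) * (y $ j - m $ j) * h $ j) = (y $ i - m $ i) * (h \<bullet> (y - m))"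
          by (simp add: inner_vec_def sum_distrib_left mult_ac)
        then show "(\<Sum>j\<in>UNIV. (y $ i - m $ i) * (y $ j - m $ j) * h $ j)
            = (h \<bullet> y) * y $ i - m $ i * (h \<bullet> y) - (h \<bullet> m) * y $ i + m $ i * (h \<bullet> m)"
          by (simp add: inner_diff_right algebra_simps)
      qed
      also have "(\<integral>y. (h \<bullet> y) * y $ i - m $ i * (h \<bullet> y) - (h \<bullet> m) * y $ i + m $ i * (h \<bullet> m) \<partial>?P)
          = (\<integral>y. (h \<bullet> y) * y $ i \<partial>?P) - m $ i * (h \<bullet> m) - (h \<bullet> m) * m $ i + m $ i * (h \<bullet> m)"
        using int_hyi int_hy int_yi int_c[of "m $ i * (h \<bullet> m)"]
        by (simp add: mi mh integral_tilted_const[OF p] del: integral_const lebesgue_integral_const)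
      also have "(\<integral>y. (h \<bullet> y) * y $ i \<partial>?P) = (\<integral>y. (h \<bullet> y) *\<^sub>R y \<partial>?P) $ i"
        using integral_inner_right[OF int_hyy[of h], of "axis i 1"] by (simp add: inner_axis')
      finally show "(covariance ?P *v h) $ i
          = ((\<integral>y. (h \<bullet> y) *\<^sub>R y \<partial>?P) - (h \<bullet> mean ?P) *\<^sub>R mean ?P) $ i"
        by (simp add: m_def)
    qed
  qed
  have "((\<lambda>t. inverse (laplace p t) *\<^sub>R (\<integral>y. exp (t \<bullet> y - p y) *\<^sub>R y \<partial>lborel)) has_derivative
      (\<lambda>h. inverse (laplace p \<theta>) *\<^sub>R (F *\<^sub>R (\<integral>y. (h \<bullet> y) *\<^sub>R y \<partial>?P))
        + (- (inverse (laplace p \<theta>) * (F * (h \<bullet> mean ?P)) * inverse (laplace p \<theta>)))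
          *\<^sub>R (\<integral>y. exp (\<theta> \<bullet> y - p y) *\<^sub>R y \<partial>lborel))) (at \<theta>)"
    by (intro has_derivative_scaleR dM Deriv.has_derivative_inverse dF) (use F in \<open>simp add: F_def\<close>)
  moreover have "inverse (laplace p \<theta>) *\<^sub>R (F *\<^sub>R (\<integral>y. (h \<bullet> y) *\<^sub>R y \<partial>?P))
        + (- (inverse (laplace p \<theta>) * (F * (h \<bullet> mean ?P)) * inverse (laplace p \<theta>)))
          *\<^sub>R (\<integral>y. exp (\<theta> \<bullet> y - p y) *\<^sub>R y \<partial>lborel) = covariance ?P *v h" for h
    using F by (simp add: F_def[symmetric] cov mean_eq[of \<theta>])
  ultimately show "((\<lambda>\<theta>. mean (tilted p \<theta>)) has_derivative (\<lambda>h. covariance ?P *v h)) (at \<theta>)"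
    by (simp only: mean_eq[abs_def])
qed

lemma transpose_covariance: "transpose (covariance M) = covariance M"
  by (simp add: transpose_def covariance_def vec_eq_iff mult.commute)

section \<open>Second differences and Hessians\<close>

lemma second_derivative_nonpos_at_max:
  fixes f g :: "real \<Rightarrow> real"
  assumes f: "\<And>t. (f has_real_derivative g t) (at t)" and g: "(g has_real_derivative c) (at 0)"
    and "g 0 = 0" and max: "\<And>t. f t \<le> f 0"
  shows "c \<le> 0"
proof (rule ccontr)
  assume "\<not> c \<le> 0"
  then obtain d where d: "d > 0" "\<And>h. h > 0 \<Longrightarrow> h < d \<Longrightarrow> g 0 < g (0 + h)"
    using DERIV_pos_inc_right[OF g] by (metis not_le)
  obtain z where z: "0 < z" "z < d / 2" "f (d / 2) - f 0 = (d / 2 - 0) * g z"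
    using MVT2[of 0 "d / 2" f g] f d(1) by auto
  have "0 < g z" using d(2)[of z] z \<open>g 0 = 0\<close> by simp
  then have "0 < (d / 2 - 0) * g z" using d(1) by simp
  then show False using z(3) max[of "d / 2"] by linarith
qed

text \<open>
  Both directions study \<open>t \<mapsto> second_diff f m (t z) - t^2 (z \<bullet> A z)\<close>, which vanishes to first order at
  \<open>0\<close> and whose second derivative compares the Hessian forms at \<open>m + t z\<close> and \<open>m - t z\<close> with that of \<open>A\<close>. The
  equivalence is used in one direction for the potentials of the marginals and in the other for log-Laplace
  transforms.
\<close>

lemma second_diff_bound_iff_hessian_bound:
  fixes f :: "real^'n \<Rightarrow> real" and g :: "real^'n \<Rightarrow> real^'n" and J :: "real^'n \<Rightarrow> real^'n^'n" and A :: "real^'n^'n"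
  assumes f: "\<And>x. (f has_derivative (\<lambda>h. h \<bullet> g x)) (at x)"
    and g: "\<And>x. (g has_derivative (\<lambda>h. J x *v h)) (at x)"
  shows "(\<forall>m z. second_diff f m z \<le> z \<bullet> (A *v z)) \<longleftrightarrow> (\<forall>x z. z \<bullet> (J x *v z) \<le> z \<bullet> (A *v z))"
proof -
  define d where "d m z t = second_diff f m (t *\<^sub>R z) - t\<^sup>2 * (z \<bullet> (A *v z))" for m z and t :: real
  define d' where "d' m z t = z \<bullet> g (m + t *\<^sub>R z) - z \<bullet> g (m - t *\<^sub>R z) - 2 * t * (z \<bullet> (A *v z))" for m z and t :: real
  define d'' where "d'' m z t = z \<bullet> (J (m + t *\<^sub>R z) *v z) + z \<bullet> (J (m - t *\<^sub>R z) *v z) - 2 * (z \<bullet> (A *v z))"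
    for m z and t :: real
  have D1: "(d m z has_real_derivative d' m z t) (at t)" for m z t
  proof -
    have "((\<lambda>t. f (m + t *\<^sub>R z)) has_derivative (\<lambda>s. (s *\<^sub>R z) \<bullet> g (m + t *\<^sub>R z))) (at t)"
      by (rule has_derivative_compose[OF _ f]) (auto intro!: derivative_eq_intros)
    moreover have "((\<lambda>t. f (m - t *\<^sub>R z)) has_derivative (\<lambda>s. (- (s *\<^sub>R z)) \<bullet> g (m - t *\<^sub>R z))) (at t)"
      by (rule has_derivative_compose[OF _ f]) (auto intro!: derivative_eq_intros)
    ultimately have "((\<lambda>t. f (m + t *\<^sub>R z) + f (m - t *\<^sub>R z) - 2 * f m - t\<^sup>2 * (z \<bullet> (A *v z))) has_derivative
        (\<lambda>s. s * d' m z t)) (at t)"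
      by (auto intro!: derivative_eq_intros simp: d'_def algebra_simps)
    also have "(\<lambda>s. s * d' m z t) = (*) (d' m z t)" by (auto simp: mult.commute)
    finally show ?thesis by (simp add: d_def[abs_def] second_diff_def has_field_derivative_def)
  qed
  have D2: "(d' m z has_real_derivative d'' m z t) (at t)" for m z t
  proof -
    have "((\<lambda>t. g (m + t *\<^sub>R z)) has_derivative (\<lambda>s. J (m + t *\<^sub>R z) *v (s *\<^sub>R z))) (at t)"
      by (rule has_derivative_compose[OF _ g]) (auto intro!: derivative_eq_intros)
    moreover have "((\<lambda>t. g (m - t *\<^sub>R z)) has_derivative (\<lambda>s. J (m - t *\<^sub>R z) *v (- (s *\<^sub>R z)))) (at t)"
      by (rule has_derivative_compose[OF _ g]) (auto intro!: derivative_eq_intros)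
    ultimately have "((\<lambda>t. z \<bullet> g (m + t *\<^sub>R z) - z \<bullet> g (m - t *\<^sub>R z) - 2 * t * (z \<bullet> (A *v z))) has_derivative
        (\<lambda>s. z \<bullet> (J (m + t *\<^sub>R z) *v (s *\<^sub>R z)) - z \<bullet> (J (m - t *\<^sub>R z) *v (- (s *\<^sub>R z))) - 2 * s * (z \<bullet> (A *v z)))) (at t)"
      by (auto intro!: derivative_eq_intros)
    also have "(\<lambda>s. z \<bullet> (J (m + t *\<^sub>R z) *v (s *\<^sub>R z)) - z \<bullet> (J (m - t *\<^sub>R z) *v (- (s *\<^sub>R z))) - 2 * s * (z \<bullet> (A *v z)))
        = (*) (d'' m z t)"
      by (rule ext) (simp add: d''_def matrix_vector_mult_scaleR algebra_simps flip: scaleR_minus_left)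
    finally show ?thesis by (simp add: d'_def[abs_def] has_field_derivative_def)
  qed
  show ?thesis
  proof (intro iffI allI)
    fix x z assume le: "\<forall>m z. second_diff f m z \<le> z \<bullet> (A *v z)"
    have "d'' x z 0 \<le> 0"
    proof (rule second_derivative_nonpos_at_max[OF D1 D2])
      fix t
      have "second_diff f x (t *\<^sub>R z) \<le> (t *\<^sub>R z) \<bullet> (A *v (t *\<^sub>R z))" using le by blast
      then show "d x z t \<le> d x z 0"
        by (simp add: d_def second_diff_def matrix_vector_mult_scaleR power2_eq_square)
    qed (simp add: d'_def)
    then show "z \<bullet> (J x *v z) \<le> z \<bullet> (A *v z)" by (simp add: d''_def)
  next
    fix m z assume le: "\<forall>x z. z \<bullet> (J x *v z) \<le> z \<bullet> (A *v z)"
    have d''_le: "d'' m z t \<le> 0" for t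
      using le[rule_format, of z "m + t *\<^sub>R z"] le[rule_format, of z "m - t *\<^sub>R z"] by (simp add: d''_def)
    have d'_le: "d' m z t \<le> 0" if "t \<ge> 0" for t
    proof -
      have "d' m z t \<le> d' m z 0"
        using D2 d''_le by (intro DERIV_nonpos_imp_nonincreasing[OF that]) blast
      then show ?thesis by (simp add: d'_def)
    qed
    have "d m z 1 \<le> d m z 0" using D1 d'_le by (intro DERIV_nonpos_imp_nonincreasing[OF zero_le_one]) blast
    then show "second_diff f m z \<le> z \<bullet> (A *v z)" by (simp add: d_def second_diff_def)
  qed
qed

lemma second_diff_bound_iff_hessian_bound_below:
  fixes f :: "real^'n \<Rightarrow> real" and g :: "real^'n \<Rightarrow> real^'n" and J :: "real^'n \<Rightarrow> real^'n^'n" and A :: "real^'n^'n"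
  assumes f: "\<And>x. (f has_derivative (\<lambda>h. h \<bullet> g x)) (at x)"
    and g: "\<And>x. (g has_derivative (\<lambda>h. J x *v h)) (at x)"
  shows "(\<forall>m z. z \<bullet> (A *v z) \<le> second_diff f m z) \<longleftrightarrow> (\<forall>x z. z \<bullet> (A *v z) \<le> z \<bullet> (J x *v z))"
proof -
  have neg: "(- M) *v z = - (M *v z)" for M :: "real^'n^'n" and z
    by (metis diff_0 matrix_vector_mult_0 matrix_vector_mult_diff_rdistrib)
  have "((\<lambda>x. - f x) has_derivative (\<lambda>h. h \<bullet> - g x)) (at x)" for x
    using has_derivative_minus[OF f[of x]] by simp
  moreover have "((\<lambda>x. - g x) has_derivative (\<lambda>h. (- J x) *v h)) (at x)" for x
    using has_derivative_minus[OF g[of x]] by (simp add: neg)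
  ultimately show ?thesis
    using second_diff_bound_iff_hessian_bound[of "\<lambda>x. - f x" "\<lambda>x. - g x" "\<lambda>x. - J x" "- A"]
    by (simp add: neg second_diff_def algebra_simps)
qed

text \<open>
  The transpose appears because \<open>hess f = nabla (grad f)\<close> is the transposed Jacobian of the
  gradient; a matrix and its transpose have the same quadratic form.
\<close>

lemma smooth_has_hessian:
  assumes "smooth f"
  shows "(f has_derivative (\<lambda>h. h \<bullet> grad f x)) (at x)"
    and "(grad f has_derivative (\<lambda>h. transpose (hess f x) *v h)) (at x)"
proof -
  have "C_k (Suc (Suc 0)) f" using assms unfolding smooth_def by blast
  then have f: "f differentiable (at x)" and f': "(\<lambda>x. frechet_derivative f (at x) v) differentiable (at x)" for x v
    by auto
  show "(f has_derivative (\<lambda>h. h \<bullet> grad f x)) (at x)"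
  proof -
    have lin: "linear (frechet_derivative f (at x))" using f by (rule linear_frechet_derivative)
    have "frechet_derivative f (at x) h = h \<bullet> grad f x" for h
    proof -
      have "frechet_derivative f (at x) h = frechet_derivative f (at x) (\<Sum>i\<in>UNIV. h $ i *\<^sub>R axis i 1)"
        by (simp add: basis_expansion flip: scalar_mult_eq_scaleR)
      also have "\<dots> = (\<Sum>i\<in>UNIV. h $ i * frechet_derivative f (at x) (axis i 1))"
        using lin by (simp add: linear_sum linear_scale)
      finally show ?thesis by (simp add: grad_def inner_vec_def)
    qed
    then have "frechet_derivative f (at x) = (\<lambda>h. h \<bullet> grad f x)" by auto
    then show ?thesis using f frechet_derivative_works by metis
  qed
  have "grad f differentiable (at x)"
    unfolding differentiable_componentwise_within[of "grad f"] by (auto simp: Basis_vec_def grad_def inner_axis f')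
  then show "(grad f has_derivative (\<lambda>h. transpose (hess f x) *v h)) (at x)"
    by (simp add: jacobian_works hess_def nabla_def)
qed

lemma loewner_leI:
  assumes "transpose A = A" "transpose B = B" "\<And>z. z \<bullet> (A *v z) \<le> z \<bullet> (B *v z)"
  shows "A \<preceq> B"
proof -
  have "transpose (B - A) = B - A" using assms(1,2) by (simp add: transpose_def vec_eq_iff)
  then show ?thesis
    using assms(3) by (simp add: loewner_le_def psd_def matrix_vector_mult_diff_rdistrib inner_diff_right)
qed

lemma loewner_leD: "A \<preceq> B \<Longrightarrow> z \<bullet> (A *v z) \<le> z \<bullet> (B *v z)"
  by (simp add: loewner_le_def psd_def matrix_vector_mult_diff_rdistrib inner_diff_right)

lemma loewner_congruence:
  fixes A B X :: "real^'n^'n"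
  assumes "A \<preceq> B"
  shows "transpose X ** A ** X \<preceq> transpose X ** B ** X"
proof -
  have distrib: "transpose X ** B ** X - transpose X ** A ** X = transpose X ** (B - A) ** X"
    by (simp add: matrix_matrix_mult_def vec_eq_iff sum_subtractf algebra_simps)
  have "transpose (B - A) = B - A" using assms by (simp add: loewner_le_def psd_def)
  then have "transpose (transpose X ** (B - A) ** X) = transpose X ** (B - A) ** X"
    by (simp add: matrix_transpose_mul matrix_mul_assoc)
  moreover have "0 \<le> v \<bullet> ((transpose X ** (B - A) ** X) *v v)" for v
  proof -
    have "v \<bullet> ((transpose X ** (B - A) ** X) *v v) = (X *v v) \<bullet> ((B - A) *v (X *v v))"
      by (simp add: inner_transpose_mult del: transpose_matrix_vector flip: matrix_vector_mul_assoc)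
    then show ?thesis using assms by (simp add: loewner_le_def psd_def)
  qed
  ultimately show ?thesis unfolding loewner_le_def distrib psd_def by blast
qed

lemma smooth_second_diff_le:
  assumes "smooth f" "\<And>x. hess f x \<preceq> A"
  shows "second_diff f m z \<le> z \<bullet> (A *v z)"
proof -
  have "z \<bullet> (transpose (hess f x) *v z) \<le> z \<bullet> (A *v z)" for x z
    unfolding inner_transpose_mult using loewner_leD[OF assms(2)] by (simp add: inner_commute)
  then show ?thesis
    using second_diff_bound_iff_hessian_bound[OF smooth_has_hessian[OF assms(1)]] by blast
qed

lemma smooth_second_diff_ge:
  assumes "smooth f" "\<And>x. A \<preceq> hess f x"
  shows "z \<bullet> (A *v z) \<le> second_diff f m z"
proof -
  have "z \<bullet> (A *v z) \<le> z \<bullet> (transpose (hess f x) *v z)" for x z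
    unfolding inner_transpose_mult using loewner_leD[OF assms(2)] by (simp add: inner_commute)
  then show ?thesis
    using second_diff_bound_iff_hessian_bound_below[OF smooth_has_hessian[OF assms(1)]] by blast
qed

section \<open>Covariance bounds and the Schroedinger bridge\<close>

lemma covariance_tilted_le:
  assumes "laplace_finite p" "transpose S = S" "\<And>\<theta> h. second_diff (log_laplace p) \<theta> h \<le> h \<bullet> (S *v h)"
  shows "covariance (tilted p \<theta>) \<preceq> S"
  using second_diff_bound_iff_hessian_bound[OF has_derivative_mean_tilted[OF assms(1)], of S] assms(2,3)
  by (intro loewner_leI transpose_covariance) auto

lemma covariance_tilted_ge:
  assumes "laplace_finite p" "transpose S = S" "\<And>\<theta> h. h \<bullet> (S *v h) \<le> second_diff (log_laplace p) \<theta> h"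
  shows "S \<preceq> covariance (tilted p \<theta>)"
  using second_diff_bound_iff_hessian_bound_below[OF has_derivative_mean_tilted[OF assms(1)], of S] assms(2,3)
  by (intro loewner_leI transpose_covariance) auto

text \<open>
  The pair generated by the Riccati matrix of one side and the pair generated by that of the other side
  both satisfy the coupled equations, and each supplies the closed form of one of the two bounds.
\<close>

theorem coupled_covariance_bounds:
  fixes u v X :: "real^'n^'n"
  assumes p: "laplace_finite p" and q: "laplace_finite q"
    and p_eq: "\<And>y. p y = V y + log_laplace q (transpose X *v y) + c"
    and q_eq: "\<And>x. q x = U x + log_laplace p (X *v x) + d"
    and X: "invertible X" and smooth: "smooth U" "smooth V"
    and u: "posdef u" and v: "posdef v"
    and U: "\<And>x. hess U x \<preceq> matrix_inv u" and V: "\<And>y. matrix_inv v \<preceq> hess V y"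
  shows "covariance (tilted p \<theta>)
      \<preceq> msqrt v ** riccati_r (matrix_inv (msqrt v ** (X ** u ** transpose X) ** msqrt v)) ** msqrt v"
      (is "_ \<preceq> ?S")
    and "msqrt u ** riccati_r (matrix_inv (msqrt u ** (transpose X ** v ** X) ** msqrt u)) ** msqrt u
      \<preceq> covariance (tilted q \<theta>)" (is "?T \<preceq> _")
proof -
  note curvature = coupled_log_laplace_curvature[OF p q p_eq q_eq u v _ _ _ _
      smooth_second_diff_le[OF smooth(1) U] smooth_second_diff_ge[OF smooth(2) V]]
  note S = riccati_fixed_pair[OF u v X refl refl refl]
  have "second_diff (log_laplace p) \<theta> h \<le> h \<bullet> (?S *v h)" for \<theta> h
    by (rule curvature(1)[OF S])
  moreover have "transpose ?S = ?S" using S(1) by (simp add: posdef_def)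
  ultimately show "covariance (tilted p \<theta>) \<preceq> ?S" by (intro covariance_tilted_le[OF p])
  \<comment> \<open>The roles of the two sides are exchanged here: the Riccati matrix now produces the lower bound directly.\<close>
  note T = riccati_fixed_pair[OF v u transpose_invertible[OF X] refl refl refl, unfolded transpose_transpose]
  have "h \<bullet> (?T *v h) \<le> second_diff (log_laplace q) \<theta> h" for \<theta> h
    by (rule curvature(2)[OF T(2,1,4,3)])
  moreover have "transpose ?T = ?T" using T(1) by (simp add: posdef_def)
  ultimately show "?T \<preceq> covariance (tilted q \<theta>)" by (intro covariance_tilted_ge[OF q])
qed

text \<open>
  Chain rule; symmetry of the covariance turns the transposed Jacobian into \<open>X' Cov\<close>.
\<close>

lemma nabla_mean_tilted:
  fixes p :: "real^'n \<Rightarrow> real"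
  assumes p: "laplace_finite p"
  shows "(\<lambda>z. mean (tilted p (X *v z))) differentiable (at x)"
    and "nabla (\<lambda>z. mean (tilted p (X *v z))) x = transpose X ** covariance (tilted p (X *v x))"
proof -
  let ?C = "covariance (tilted p (X *v x))"
  have D: "((\<lambda>z. mean (tilted p (X *v z))) has_derivative (\<lambda>h. ?C *v (X *v h))) (at x)"
    by (rule has_derivative_compose[OF _ has_derivative_mean_tilted(2)[OF p]])
      (intro bounded_linear_imp_has_derivative matrix_vector_mul_bounded_linear)
  then show "(\<lambda>z. mean (tilted p (X *v z))) differentiable (at x)" by (rule differentiableI)
  have "jacobian (\<lambda>z. mean (tilted p (X *v z))) (at x) = ?C ** X"
    unfolding jacobian_def frechet_derivative_at[OF D, symmetric]
    by (simp add: matrix_vector_mul_assoc matrix_of_matrix_vector_mul)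
  then show "nabla (\<lambda>z. mean (tilted p (X *v z))) x = transpose X ** ?C"
    by (simp add: nabla_def matrix_transpose_mul transpose_covariance)
qed

lemma integrable_norm_square_tilted:
  assumes "laplace_finite p"
  shows "integrable (tilted p \<theta>) (\<lambda>y. (norm y)\<^sup>2)"
proof (rule integrable_tilted[OF assms, of _ 1 2])
  fix y :: "real^'n"
  have "norm y \<le> exp (norm y)" using exp_ge_add_one_self[of "norm y"] by linarith
  then have "(norm y)\<^sup>2 \<le> (exp (norm y))\<^sup>2" by (intro power_mono) auto
  then show "norm ((norm y)\<^sup>2) \<le> 1 * exp (2 * norm y)" by (simp add: exp_double)
qed measurable

lemma posdef_det_pos:
  fixes A :: "real^'n^'n"
  assumes "posdef A"
  shows "det A > 0"
proof -
  have "det A = (det (msqrt A))\<^sup>2" using msqrt_posdef(2)[OF assms] by (metis det_mul power2_eq_square)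
  moreover have "det (msqrt A) \<noteq> 0"
    using posdef_imp_invertible[OF msqrt_posdef(1)[OF assms]] by (simp add: invertible_det_nz)
  ultimately show ?thesis by simp
qed

lemma neg_ln_gauss_density:
  fixes t :: "real^'n^'n"
  assumes "posdef t"
  shows "- ln (gauss_density t z) = (z \<bullet> (matrix_inv t *v z)) / 2 + ln (sqrt ((2 * pi) ^ CARD('n) * det t))"
  using posdef_det_pos[OF assms] by (simp add: gauss_density_def ln_div)

lemma smooth_borel_measurable: "smooth f \<Longrightarrow> (f :: real^'n \<Rightarrow> real) \<in> borel_measurable borel"
  using C_k.simps(1)[of f] unfolding smooth_def by (metis borel_measurable_continuous_onI)

text \<open>
  Extracts from one equation of the Schroedinger system that the exponential family is defined
  on the whole space: the parameters \<open>X x\<close> exhaust it because \<open>X\<close> is invertible.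
\<close>

lemma laplace_finite_of_shifted_potential:
  fixes X :: "real^'n^'n" and G :: "real^'n \<Rightarrow> real^'n \<Rightarrow> real"
  assumes [measurable]: "p \<in> borel_measurable borel" and X: "invertible X"
    and G: "\<And>x y. G x y = (X *v x) \<bullet> y - p y - a x"
    and int: "\<And>x. integrable lborel (\<lambda>y. exp (G x y))"
  shows "laplace_finite p" and "ln (\<integral>y. exp (G x y) \<partial>lborel) = log_laplace p (X *v x) - a x"
proof -
  have split: "exp (G x y) = exp (- a x) * exp ((X *v x) \<bullet> y - p y)" for x y
    by (simp add: G flip: exp_add)
  have "integrable lborel (\<lambda>y. exp (\<theta> \<bullet> y - p y))" for \<theta>
  proof -
    have \<theta>: "X *v (matrix_inv X *v \<theta>) = \<theta>"
      by (simp add: matrix_vector_mul_assoc matrix_inv_cancel[OF X])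
    show ?thesis using int[of "matrix_inv X *v \<theta>"] unfolding split \<theta> by simp
  qed
  then show p: "laplace_finite p" by (simp add: laplace_finite_def)
  have "(\<integral>y. exp (G x y) \<partial>lborel) = exp (- a x) * laplace p (X *v x)"
    by (simp add: split laplace_def)
  then show "ln (\<integral>y. exp (G x y) \<partial>lborel) = log_laplace p (X *v x) - a x"
    using laplace_pos[OF p, of "X *v x"] by (simp add: log_laplace_def ln_mult)
qed

theorem theorem3p9:
  fixes U V UU VV :: "real^'n \<Rightarrow> real"
    and W WW WWb :: "real^'n \<Rightarrow> real^'n \<Rightarrow> real"
    and \<tau> \<beta> chi :: "real^'n^'n"
    and \<alpha> :: "real^'n"
    and \<mu> \<eta> :: "(real^'n) measure"
    and P B :: "((real^'n) \<times> (real^'n)) measure"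
    and K Kb :: "real^'n \<Rightarrow> (real^'n) measure"
  assumes tau: "posdef \<tau>"
    and beta: "invertible \<beta>"
    and chi: "chi = matrix_inv \<tau> ** \<beta>"
    and W: "W = (\<lambda>x y. - ln (gauss_density \<tau> (y - (\<alpha> + \<beta> *v x))))"
    and smooth_marginals: "smooth U" "smooth V"
    and mu: "\<mu> = pot_measure U" "prob_space \<mu>"
    and eta: "\<eta> = pot_measure V" "prob_space \<eta>"
    and P: "P = kernel_prod \<mu> (pot_kernel W)"
    and finite_entropy: "\<exists>Q \<in> couplings \<mu> \<eta>. rel_entropy Q P < \<infinity>"
    and bridge: "is_schroedinger_bridge P \<mu> \<eta> B"
    and smooth_bridge: "smooth UU" "smooth VV"
    and system: "schroedinger_system U V W UU VV"
    and WW: "\<And>x y. U x + WW x y = UU x + W x y + VV y"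
    and WWb: "\<And>x y. V y + WWb y x = UU x + W x y + VV y"
    and K: "K = pot_kernel WW"
    and Kb: "Kb = pot_kernel WWb"
    and bridge_forward: "B = kernel_prod \<mu> K"
    and bridge_backward: "B = distr (kernel_prod \<eta> Kb) borel (\<lambda>(y, x). (x, y))"
  shows
    "(\<forall>x. integrable (K x) (\<lambda>y. (norm y)\<^sup>2) \<and>
          (\<lambda>z. mean (K z)) differentiable (at x) \<and>
          transpose chi ** covariance (K x) ** chi = nabla (\<lambda>z. mean (K z)) x ** chi)
   \<and> (\<forall>y. integrable (Kb y) (\<lambda>x. (norm x)\<^sup>2) \<and>
          (\<lambda>z. mean (Kb z)) differentiable (at y) \<and>
          chi ** covariance (Kb y) ** transpose chi
            = nabla (\<lambda>z. mean (Kb z)) y ** transpose chi)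
   \<and> (\<forall>um vp. posdef um \<and> posdef vp \<and>
          (\<forall>x. hess U x \<preceq> matrix_inv um) \<and> (\<forall>y. matrix_inv vp \<preceq> hess V y) \<longrightarrow>
        (let w0 = matrix_inv (msqrt vp ** (chi ** um ** transpose chi) ** msqrt vp);
             w1 = matrix_inv (msqrt um ** (transpose chi ** vp ** chi) ** msqrt um)
         in (\<forall>x. nabla (\<lambda>z. mean (K z)) x ** chi
                   \<preceq> transpose chi ** msqrt vp ** riccati_r w0 ** msqrt vp ** chi)
          \<and> (\<forall>y. chi ** msqrt um ** riccati_r w1 ** msqrt um ** transpose chi
                   \<preceq> nabla (\<lambda>z. mean (Kb z)) y ** transpose chi)))
   \<and> (\<forall>up vm. posdef up \<and> posdef vm \<and>
          (\<forall>x. matrix_inv up \<preceq> hess U x) \<and> (\<forall>y. hess V y \<preceq> matrix_inv vm) \<longrightarrow>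
        (let w1 = matrix_inv (msqrt up ** (transpose chi ** vm ** chi) ** msqrt up);
             w0 = matrix_inv (msqrt vm ** (chi ** up ** transpose chi) ** msqrt vm)
         in (\<forall>y. nabla (\<lambda>z. mean (Kb z)) y ** transpose chi
                   \<preceq> chi ** msqrt up ** riccati_r w1 ** msqrt up ** transpose chi)
          \<and> (\<forall>x. transpose chi ** msqrt vm ** riccati_r w0 ** msqrt vm ** chi
                   \<preceq> nabla (\<lambda>z. mean (K z)) x ** chi)))"
proof -
  define Ti where "Ti = matrix_inv \<tau>"
  have Ti_sym: "transpose Ti = Ti" using posdef_matrix_inv[OF tau] by (simp add: Ti_def posdef_def)
  have chi_inv: "invertible chi"
    unfolding chi by (intro invertible_mult invertible_matrix_inv posdef_imp_invertible tau beta)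
  have chi_mult: "chi *v x = Ti *v (\<beta> *v x)" for x
    by (simp add: chi Ti_def matrix_vector_mul_assoc)
  have Ti_swap: "z \<bullet> (Ti *v y) = y \<bullet> (Ti *v z)" for y z
    using symmetric_inner_swap[OF Ti_sym, of z y] by (simp add: inner_commute)
  define l where "l = ln (sqrt ((2 * pi) ^ CARD('n) * det \<tau>))"
  define Q where "Q y z = y \<bullet> (Ti *v z)" for y z
  have W_eq: "W x y = Q (y - (\<alpha> + \<beta> *v x)) (y - (\<alpha> + \<beta> *v x)) / 2 + l" for x y
    by (simp add: W neg_ln_gauss_density[OF tau] Q_def Ti_def l_def)
  have Q_bilinear: "Q (y + y') z = Q y z + Q y' z" "Q y (z + z') = Q y z + Q y z'"
    "Q (y - y') z = Q y z - Q y' z" "Q y (z - z') = Q y z - Q y z'" for y y' z z'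
    by (simp_all add: Q_def inner_add_left inner_add_right inner_diff_left inner_diff_right
        matrix_vector_right_distrib matrix_vector_mult_diff_distrib)
  have Q_sym: "Q z y = Q y z" for y z unfolding Q_def by (rule Ti_swap)
  have chi_Q: "(chi *v x) \<bullet> y = Q y (\<beta> *v x)" "(transpose chi *v y) \<bullet> x = Q y (\<beta> *v x)" for x y
    using inner_transpose_mult[of x chi y]
    by (simp_all add: Q_def chi_mult inner_commute del: transpose_matrix_vector)
  \<comment> \<open>The Gaussian exponent splits into a part in \<open>y\<close>, a part in \<open>x\<close> and the bilinear term
    \<open>(chi x) \<bullet> y = (chi' y) \<bullet> x\<close>. The potential \<open>p\<close> absorbs the first part, \<open>q\<close> the one that depends on \<open>x\<close> when
    \<open>y\<close> is the parameter; \<open>a\<close> and \<open>b\<close> are the corresponding normalizations.\<close>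
  define p where "p y = Q (y - \<alpha>) (y - \<alpha>) / 2 + VV y" for y
  define q where "q x = Q (\<alpha> + \<beta> *v x) (\<alpha> + \<beta> *v x) / 2 + UU x" for x
  define a where "a x = l + Q \<alpha> (\<beta> *v x) + Q (\<beta> *v x) (\<beta> *v x) / 2" for x
  define b where "b y = l + Q y y / 2 - Q \<alpha> y" for y
  have forward: "- W x y - VV y = (chi *v x) \<bullet> y - p y - a x" for x y
    unfolding W_eq chi_Q p_def a_def Q_bilinear
    by (simp add: Q_sym[of \<alpha> y] Q_sym[of \<alpha> "\<beta> *v x"] Q_sym[of y "\<beta> *v x"] field_simps)
  have backward: "- W x y - UU x = (transpose chi *v y) \<bullet> x - q x - b y" for x y
    unfolding W_eq chi_Q q_def b_def Q_bilinear
    by (simp add: Q_sym[of \<alpha> y] Q_sym[of \<alpha> "\<beta> *v x"] Q_sym[of y "\<beta> *v x"] field_simps)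
  have [measurable]: "UU \<in> borel_measurable borel" "VV \<in> borel_measurable borel"
    using smooth_bridge by (auto intro: smooth_borel_measurable)
  have lin[measurable]: "(\<lambda>y. M *v y) \<in> borel_measurable borel" for M :: "real^'n^'n"
    by (intro borel_measurable_continuous_onI linear_continuous_on matrix_vector_mul_bounded_linear)
  have mp: "p \<in> borel_measurable borel" and mq: "q \<in> borel_measurable borel"
    unfolding p_def[abs_def] q_def[abs_def] Q_def by measurable
  note sys = system[unfolded schroedinger_system_def]
  have int_forward: "integrable lborel (\<lambda>y. exp (- W x y - VV y))" for x using sys by blast
  have int_backward: "integrable lborel (\<lambda>x. exp (- W x y - UU x))" for y using sys by blast
  note p = laplace_finite_of_shifted_potential(1)[OF mp chi_inv forward int_forward]
  note q = laplace_finite_of_shifted_potential(1)[OF mq transpose_invertible[OF chi_inv] backward int_backward]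
  have UU_eq: "UU x = U x + log_laplace p (chi *v x) - a x" for x
  proof -
    have "UU x = U x + ln (\<integral>y. exp (- W x y - VV y) \<partial>lborel)" using sys by blast
    then show ?thesis
      using laplace_finite_of_shifted_potential(2)[OF mp chi_inv forward int_forward, of x] by linarith
  qed
  have VV_eq: "VV y = V y + log_laplace q (transpose chi *v y) - b y" for y
  proof -
    have "VV y = V y + ln (\<integral>x. exp (- W x y - UU x) \<partial>lborel)" using sys by blast
    then show ?thesis
      using laplace_finite_of_shifted_potential(2)[OF mq transpose_invertible[OF chi_inv] backward int_backward, of y]
      by linarith
  qed
  \<comment> \<open>Because the quadratic parts cancel, \<open>p\<close> and \<open>q\<close> inherit their curvature from the marginals and from each other alone.\<close>
  have p_eq: "p y = V y + log_laplace q (transpose chi *v y) + (Q \<alpha> \<alpha> / 2 - l)" for y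
    unfolding p_def VV_eq b_def Q_bilinear by (simp add: Q_sym[of \<alpha> y] field_simps)
  have q_eq: "q x = U x + log_laplace p (chi *v x) + (Q \<alpha> \<alpha> / 2 - l)" for x
    unfolding q_def UU_eq a_def Q_bilinear by (simp add: Q_sym[of \<alpha> "\<beta> *v x"] field_simps)
  have K_eq: "K = (\<lambda>x. tilted p (chi *v x))"
  proof
    fix x
    have "WW x y = log_laplace p (chi *v x) + p y - (chi *v x) \<bullet> y" for y
      using WW[of x y] forward[of x y] UU_eq[of x] by linarith
    then have "WW x = (\<lambda>y. log_laplace p (chi *v x) + p y - (chi *v x) \<bullet> y)" by blast
    then show "K x = tilted p (chi *v x)" by (simp only: K pot_kernel_def tilted_def)
  qed
  have Kb_eq: "Kb = (\<lambda>y. tilted q (transpose chi *v y))"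
  proof
    fix y
    have "WWb y x = log_laplace q (transpose chi *v y) + q x - (transpose chi *v y) \<bullet> x" for x
      using WWb[of y x] backward[of x y] VV_eq[of y] by linarith
    then have "WWb y = (\<lambda>x. log_laplace q (transpose chi *v y) + q x - (transpose chi *v y) \<bullet> x)" by blast
    then show "Kb y = tilted q (transpose chi *v y)" by (simp only: Kb pot_kernel_def tilted_def)
  qed
  have congruence_forward: "A \<preceq> B \<Longrightarrow> transpose chi ** A ** chi \<preceq> transpose chi ** B ** chi" for A B
    by (rule loewner_congruence)
  have congruence_backward: "A \<preceq> B \<Longrightarrow> chi ** A ** transpose chi \<preceq> chi ** B ** transpose chi" for A B
    using loewner_congruence[of A B "transpose chi"] by simp
  have K: "integrable (K x) (\<lambda>y. (norm y)\<^sup>2)" "(\<lambda>z. mean (K z)) differentiable (at x)"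
    "nabla (\<lambda>z. mean (K z)) x ** chi = transpose chi ** covariance (K x) ** chi" for x
    unfolding K_eq
    by (rule integrable_norm_square_tilted[OF p], rule nabla_mean_tilted[OF p])
      (simp only: nabla_mean_tilted(2)[OF p])
  have Kb: "integrable (Kb y) (\<lambda>x. (norm x)\<^sup>2)" "(\<lambda>z. mean (Kb z)) differentiable (at y)"
    "nabla (\<lambda>z. mean (Kb z)) y ** transpose chi = chi ** covariance (Kb y) ** transpose chi" for y
    unfolding Kb_eq
    by (rule integrable_norm_square_tilted[OF q], rule nabla_mean_tilted[OF q])
      (simp only: nabla_mean_tilted(2)[OF q] transpose_transpose)
  have bounds_i: "covariance (K x)
        \<preceq> msqrt v ** riccati_r (matrix_inv (msqrt v ** (chi ** u ** transpose chi) ** msqrt v)) ** msqrt v"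
      "msqrt u ** riccati_r (matrix_inv (msqrt u ** (transpose chi ** v ** chi) ** msqrt u)) ** msqrt u
        \<preceq> covariance (Kb y)"
    if "posdef u" "posdef v" "\<forall>x. hess U x \<preceq> matrix_inv u" "\<forall>y. matrix_inv v \<preceq> hess V y" for u v x y
    unfolding K_eq Kb_eq
    using coupled_covariance_bounds[OF p q p_eq q_eq chi_inv smooth_marginals that(1,2)] that(3,4) by blast+
  have bounds_ii: "covariance (Kb y)
        \<preceq> msqrt u ** riccati_r (matrix_inv (msqrt u ** (transpose chi ** v ** chi) ** msqrt u)) ** msqrt u"
      "msqrt v ** riccati_r (matrix_inv (msqrt v ** (chi ** u ** transpose chi) ** msqrt v)) ** msqrt v
        \<preceq> covariance (K x)"
    if "posdef u" "posdef v" "\<forall>x. matrix_inv u \<preceq> hess U x" "\<forall>y. hess V y \<preceq> matrix_inv v" for u v x y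
    unfolding K_eq Kb_eq
    using coupled_covariance_bounds[OF q p _ p_eq transpose_invertible[OF chi_inv]
        smooth_marginals(2,1) that(2,1), unfolded transpose_transpose, OF q_eq] that(3,4) by blast+
  show ?thesis
    unfolding Let_def
  proof (intro conjI allI impI; (elim conjE)?)
    show "integrable (K x) (\<lambda>y. (norm y)\<^sup>2)" "(\<lambda>z. mean (K z)) differentiable (at x)"
      "transpose chi ** covariance (K x) ** chi = nabla (\<lambda>z. mean (K z)) x ** chi" for x
      by (simp_all only: K)
    show "integrable (Kb y) (\<lambda>x. (norm x)\<^sup>2)" "(\<lambda>z. mean (Kb z)) differentiable (at y)"
      "chi ** covariance (Kb y) ** transpose chi = nabla (\<lambda>z. mean (Kb z)) y ** transpose chi" for y
      by (simp_all only: Kb)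
  next
    fix u v :: "real^'n^'n" and x y :: "real^'n"
    assume uv: "posdef u" "posdef v" "\<forall>x. hess U x \<preceq> matrix_inv u" "\<forall>y. matrix_inv v \<preceq> hess V y"
    show "nabla (\<lambda>z. mean (K z)) x ** chi \<preceq> transpose chi ** msqrt v
        ** riccati_r (matrix_inv (msqrt v ** (chi ** u ** transpose chi) ** msqrt v)) ** msqrt v ** chi"
      using congruence_forward[OF bounds_i(1)[OF uv]] by (simp only: K matrix_mul_assoc)
    show "chi ** msqrt u ** riccati_r (matrix_inv (msqrt u ** (transpose chi ** v ** chi) ** msqrt u))
        ** msqrt u ** transpose chi \<preceq> nabla (\<lambda>z. mean (Kb z)) y ** transpose chi"
      using congruence_backward[OF bounds_i(2)[OF uv]] by (simp only: Kb matrix_mul_assoc)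
  next
    fix u v :: "real^'n^'n" and x y :: "real^'n"
    assume uv: "posdef u" "posdef v" "\<forall>x. matrix_inv u \<preceq> hess U x" "\<forall>y. hess V y \<preceq> matrix_inv v"
    show "nabla (\<lambda>z. mean (Kb z)) y ** transpose chi \<preceq> chi ** msqrt u
        ** riccati_r (matrix_inv (msqrt u ** (transpose chi ** v ** chi) ** msqrt u)) ** msqrt u ** transpose chi"
      using congruence_backward[OF bounds_ii(1)[OF uv]] by (simp only: Kb matrix_mul_assoc)
    show "transpose chi ** msqrt v ** riccati_r (matrix_inv (msqrt v ** (chi ** u ** transpose chi) ** msqrt v))
        ** msqrt v ** chi \<preceq> nabla (\<lambda>z. mean (K z)) x ** chi"
      using congruence_forward[OF bounds_ii(2)[OF uv]] by (simp only: K matrix_mul_assoc)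
  qed
qed

end
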